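(* Let $n\ge1$. For any $\varepsilon>0$, $$ \boldsymbol{b}^n_\varepsilon(x)=b_{2^{-n},\varepsilon}(x)\quad\text{for all }x\in\Omega_\varepsilon. $$
   Context: $\Omega_\varepsilon=\{x=(x_1,x_2)\in\mathbb{R}^2:\ x_1^2\le x_2\le x_1^2+\varepsilon^2\}$. Bellman function: fix a dyadic cube $Q\subset\mathbb{R}^n$; write $\langle\varphi\rangle_J=\frac1{|J|}\int_J\varphi$ and let $\mathrm{BMO}^d_\varepsilon(Q)$ be the set of real $\varphi\in L^1(Q)$ with $\sup_{J}\big(\langle|\varphi-\langle\varphi\rangle_J|^2\rangle_J\big)^{1/2}\le\varepsilon$, the supremum being over all dyadic subcubes $J$ of $Q$ (including $Q$). For $x\in\Omega_\varepsilon$, $$\boldsymbol{b}^n_{\varepsilon}(x)=\inf_{\varphi\in \mathrm{BMO}^d_{\varepsilon}(Q)}\left\{\langle|\varphi|\rangle_Q:\ \langle\varphi\rangle_Q=x_1,\ \langle\varphi^2\rangle_Q=x_2\right\}.$$ The function $b_{\alpha,\varepsilon}$: for $\varepsilon>0$ and $\alpha\in(0,1/2]$, let $\Omega^{(0)}=\big\{x:\ |x_1|\le\sqrt\alpha\,\varepsilon,\ \frac{(1+\alpha)\varepsilon}{\sqrt\alpha}|x_1|\le x_2\le x_1^2+\varepsilon^2\big\}$ and $$\Omega^{(1)}=\Big\{x:\ |x_1|\le\sqrt\alpha\,\varepsilon,\ x_1^2\le x_2\le \tfrac{(1+\alpha)\varepsilon}{\sqrt\alpha}|x_1|\Big\}\cup\Big\{x:\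 |x_1|>\sqrt\alpha\,\varepsilon,\ x_1^2\le x_2\le x_1^2+\varepsilon^2\Big\},$$ so that $\Omega_\varepsilon=\Omega^{(0)}\cup\Omega^{(1)}$. Then $$b_{\alpha,\varepsilon}(x)=\begin{cases}\frac{\sqrt\alpha}{(1+\alpha)\varepsilon}\,x_2,& x\in\Omega^{(0)},\\ |x_1|,& x\in\Omega^{(1)}\end{cases}$$ (the two expressions agree on the overlap). *)

theory Defs
  imports "HOL-Analysis.Analysis"
begin

text \<open>The standard dyadic grid: half-open cubes of side \<open>2\<^sup>m\<close>, \<open>m\<close> any integer, with corner
  in \<open>2\<^sup>m\<close> times the integer lattice.\<close>

definition dyadic_cube :: "int \<Rightarrow> (int ^ 'n) \<Rightarrow> (real ^ 'n) set" where
  "dyadic_cube m k =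
     {t. \<forall>i. of_int (k $ i) * 2 powi m \<le> t $ i \<and> t $ i < (of_int (k $ i) + 1) * 2 powi m}"

definition dyadic_cubes :: "(real ^ 'n) set set" where
  "dyadic_cubes = {dyadic_cube m k |m k. True}"

definition dyadic_subcubes :: "(real ^ 'n) set \<Rightarrow> (real ^ 'n) set set" where
  "dyadic_subcubes Q = {J \<in> dyadic_cubes. J \<subseteq> Q}"

definition avg :: "(real ^ 'n) set \<Rightarrow> (real ^ 'n \<Rightarrow> real) \<Rightarrow> real" where
  "avg J f = (LINT t:J|lebesgue. f t) / measure lebesgue J"

text \<open>The Bochner integral of a non-integrable function is \<open>0\<close>, so the finiteness of the mean
  square oscillations, implicit in the bound by \<open>\<epsilon>\<close>, has to be required separately.
  Functions are total; only their restriction to \<open>Q\<close> matters.\<close>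

definition BMO_dyadic :: "real \<Rightarrow> (real ^ 'n) set \<Rightarrow> (real ^ 'n \<Rightarrow> real) set" where
  "BMO_dyadic \<epsilon> Q = {\<phi>. set_integrable lebesgue Q \<phi> \<and>
     (\<forall>J\<in>dyadic_subcubes Q. set_integrable lebesgue J (\<lambda>t. \<bar>\<phi> t - avg J \<phi>\<bar>\<^sup>2)) \<and>
     (SUP J\<in>dyadic_subcubes Q. ereal (sqrt (avg J (\<lambda>t. \<bar>\<phi> t - avg J \<phi>\<bar>\<^sup>2)))) \<le> ereal \<epsilon>}"

definition Omega :: "real \<Rightarrow> (real \<times> real) set" where
  "Omega \<epsilon> = {(x1, x2). x1\<^sup>2 \<le> x2 \<and> x2 \<le> x1\<^sup>2 + \<epsilon>\<^sup>2}"

text \<open>The infimum is taken in the extended reals, where an empty infimum is \<open>\<infinity>\<close>.\<close>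

definition bellman :: "(real ^ 'n) set \<Rightarrow> real \<Rightarrow> real \<times> real \<Rightarrow> ereal" where
  "bellman Q \<epsilon> x =
     (INF \<phi> \<in> {\<phi> \<in> BMO_dyadic \<epsilon> Q. avg Q \<phi> = fst x \<and> avg Q (\<lambda>t. (\<phi> t)\<^sup>2) = snd x}.
        ereal (avg Q (\<lambda>t. \<bar>\<phi> t\<bar>)))"

definition Omega0 :: "real \<Rightarrow> real \<Rightarrow> (real \<times> real) set" where
  "Omega0 \<alpha> \<epsilon> = {(x1, x2). \<bar>x1\<bar> \<le> sqrt \<alpha> * \<epsilon> \<and>
     (1 + \<alpha>) * \<epsilon> / sqrt \<alpha> * \<bar>x1\<bar> \<le> x2 \<and> x2 \<le> x1\<^sup>2 + \<epsilon>\<^sup>2}"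

definition Omega1 :: "real \<Rightarrow> real \<Rightarrow> (real \<times> real) set" where
  "Omega1 \<alpha> \<epsilon> =
     {(x1, x2). \<bar>x1\<bar> \<le> sqrt \<alpha> * \<epsilon> \<and> x1\<^sup>2 \<le> x2 \<and> x2 \<le> (1 + \<alpha>) * \<epsilon> / sqrt \<alpha> * \<bar>x1\<bar>} \<union>
     {(x1, x2). \<bar>x1\<bar> > sqrt \<alpha> * \<epsilon> \<and> x1\<^sup>2 \<le> x2 \<and> x2 \<le> x1\<^sup>2 + \<epsilon>\<^sup>2}"

definition b_alpha :: "real \<Rightarrow> real \<Rightarrow> real \<times> real \<Rightarrow> real" where
  "b_alpha \<alpha> \<epsilon> x =
     (if x \<in> Omega0 \<alpha> \<epsilon> then sqrt \<alpha> / ((1 + \<alpha>) * \<epsilon>) * snd x else \<bar>fst x\<bar>)"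

text \<open>The two pieces cover \<open>\<Omega>\<^sub>\<epsilon>\<close> and the two formulas agree on the overlap, so that the
  \<open>else\<close> branch of \<^const>\<open>b_alpha\<close> is the stated value on all of \<^const>\<open>Omega1\<close>.\<close>

lemma Omega_eq_Omega0_Un_Omega1:
  assumes "0 < \<epsilon>" "0 < \<alpha>" "\<alpha> \<le> 1/2"
  shows "Omega \<epsilon> = Omega0 \<alpha> \<epsilon> \<union> Omega1 \<alpha> \<epsilon>"
proof -
  define s where "s = sqrt \<alpha>"
  have s: "0 < s" "s\<^sup>2 = \<alpha>" using assms by (auto simp: s_def)
  have s1: "s \<le> 1" using assms by (simp add: s_def)
  define c where "c = (1 + \<alpha>) * \<epsilon> / s"
  have c: "c = \<epsilon> / s + s * \<epsilon>"
    using s by (simp add: c_def field_simps power2_eq_square)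
  have es: "\<epsilon> \<le> \<epsilon> / s" "s * \<epsilon> \<le> \<epsilon>" using s s1 assms by (auto simp: field_simps)
  have prd: "\<epsilon> / s * (s * \<epsilon>) = \<epsilon>\<^sup>2" using s by (simp add: power2_eq_square)
  have up: "c * \<bar>u\<bar> \<le> u\<^sup>2 + \<epsilon>\<^sup>2" if "\<bar>u\<bar> \<le> s * \<epsilon>" for u
  proof -
    have "0 \<le> (\<epsilon> / s - \<bar>u\<bar>) * (s * \<epsilon> - \<bar>u\<bar>)"
      using that es by (intro mult_nonneg_nonneg) auto
    also have "\<dots> = \<epsilon> / s * (s * \<epsilon>) - c * \<bar>u\<bar> + \<bar>u\<bar>\<^sup>2"
      unfolding c by (simp add: algebra_simps power2_eq_square)
    finally show ?thesis unfolding prd by simp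
  qed
  have lo: "u\<^sup>2 \<le> c * \<bar>u\<bar>" if "\<bar>u\<bar> \<le> s * \<epsilon>" for u
  proof -
    have "\<bar>u\<bar> \<le> c" using that es assms s unfolding c by (smt (verit) divide_pos_pos)
    then have "\<bar>u\<bar> * \<bar>u\<bar> \<le> c * \<bar>u\<bar>" by (intro mult_right_mono) auto
    then show ?thesis by (simp add: power2_eq_square)
  qed
  show ?thesis
    unfolding Omega_def Omega0_def Omega1_def s_def[symmetric] c_def[symmetric]
    using up lo by (auto simp: not_le) (smt (verit))+
qed

lemma b_alpha_on_Omega0: "x \<in> Omega0 \<alpha> \<epsilon> \<Longrightarrow> b_alpha \<alpha> \<epsilon> x = sqrt \<alpha> / ((1 + \<alpha>) * \<epsilon>) * snd x"
  by (simp add: b_alpha_def)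

lemma b_alpha_on_Omega1:
  assumes "0 < \<epsilon>" "0 < \<alpha>" "x \<in> Omega1 \<alpha> \<epsilon>"
  shows "b_alpha \<alpha> \<epsilon> x = \<bar>fst x\<bar>"
proof (cases "x \<in> Omega0 \<alpha> \<epsilon>")
  case True
  then have "snd x = (1 + \<alpha>) * \<epsilon> / sqrt \<alpha> * \<bar>fst x\<bar>"
    using assms(3) by (auto simp: Omega0_def Omega1_def)
  moreover have "sqrt \<alpha> / ((1 + \<alpha>) * \<epsilon>) * ((1 + \<alpha>) * \<epsilon> / sqrt \<alpha> * \<bar>fst x\<bar>) = \<bar>fst x\<bar>"
    using assms by simp
  ultimately show ?thesis using True by (simp add: b_alpha_def)
qed (simp add: b_alpha_def)

end

theory Submission
  imports Defs
begin

text \<open>Put \<open>\<alpha> = 2\<^sup>-\<^sup>n\<close>, \<open>s = \<surd>\<alpha> \<epsilon>\<close> and \<open>q = \<epsilon> / \<surd>\<alpha>\<close>, so that \<open>s q = \<epsilon>\<^sup>2\<close>, \<open>s = \<alpha> q\<close> and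
  \<open>(1 + \<alpha>) \<epsilon> / \<surd>\<alpha> = s + q\<close>.

  Lower bound. Jensen's inequality gives \<open>|x\<^sub>1|\<close>. The other branch amounts to
  \<open>\<langle>\<phi>\<^sup>2\<rangle> \<le> (s + q) \<langle>|\<phi>|\<rangle>\<close> on every cube with \<open>|\<langle>\<phi>\<rangle>| \<le> q\<close>. If \<open>s \<le> |\<langle>\<phi>\<rangle>| \<le> q\<close> this follows from
  \<open>\<langle>\<phi>\<^sup>2\<rangle> \<le> \<langle>\<phi>\<rangle>\<^sup>2 + s q\<close> because \<open>(|\<langle>\<phi>\<rangle>| - s) (q - |\<langle>\<phi>\<rangle>|) \<ge> 0\<close>. If \<open>|\<langle>\<phi>\<rangle>| < s\<close> and the mean over
  one of the children exceeds \<open>q\<close> in modulus, that child has to be compensated by the others, whence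
  \<open>\<langle>|\<phi>|\<rangle> \<ge> 2 s - |\<langle>\<phi>\<rangle>|\<close>, which suffices. In the remaining case one passes to the children. The
  error after \<open>d\<close> generations is the mean square distance of \<open>\<phi>\<close> from its conditional expectation,
  which tends to \<open>0\<close>.

  Upper bound. Functions given on the children can be glued whenever the averaged point stays in
  \<open>\<Omega>\<^sub>\<epsilon>\<close>. Gluing repeatedly along the expansion of a weight in base \<open>2\<^sup>n\<close> shows that an upper bound
  for the Bellman function may be interpolated linearly along every segment contained in \<open>\<Omega>\<^sub>\<epsilon>\<close>.
  Functions without sign change are found explicitly for \<open>|x\<^sub>1| \<ge> s\<close>, and all remaining points are
  reached by segments.\<close>

subsection \<open>Dyadic cubes and averages\<close>

text \<open>Floors turn questions about disjointness and about passing between generations into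
  integer arithmetic.\<close>

lemma mem_dyadic_cube_iff_floor: "t \<in> dyadic_cube m k \<longleftrightarrow> (\<forall>i. \<lfloor>t $ i / 2 powi m\<rfloor> = k $ i)"
proof -
  have p: "(0::real) < 2 powi m" by simp
  show ?thesis
    by (simp add: dyadic_cube_def floor_eq_iff pos_le_divide_eq[OF p] pos_divide_less_eq[OF p])
qed

text \<open>A child is indexed by the set of coordinates in which it occupies the upper half, so the
  children range over the finite type \<open>'n set\<close> and sums over them run over
  \<open>UNIV\<close>.\<close>

definition dyadic_child :: "int ^ 'n \<Rightarrow> 'n set \<Rightarrow> int ^ 'n" where
  "dyadic_child k e = (\<chi> i. 2 * k $ i + (if i \<in> e then 1 else 0))"

lemma floor_half_eq_div: "\<lfloor>z / 2\<rfloor> = \<lfloor>z\<rfloor> div 2" for z :: real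
  using floor_divide_real_eq_div[of 2 z] by simp

lemma floor_powi_pred: "\<lfloor>x / 2 powi m\<rfloor> = \<lfloor>x / 2 powi (m - 1)\<rfloor> div 2" for x :: real
proof -
  have "x / 2 powi m = x / 2 powi (m - 1) / 2"
    by (simp add: power_int_diff)
  then show ?thesis by (simp only: floor_half_eq_div)
qed

lemma dyadic_cube_eq_Union_children:
  "dyadic_cube m k = (\<Union>e. dyadic_cube (m - 1) (dyadic_child k e))"
proof (intro set_eqI iffI)
  fix t assume t: "t \<in> dyadic_cube m k"
  define e where "e = {i. odd \<lfloor>t $ i / 2 powi (m - 1)\<rfloor>}"
  have "t \<in> dyadic_cube (m - 1) (dyadic_child k e)"
    unfolding mem_dyadic_cube_iff_floor
  proof
    fix i
    have "\<lfloor>t $ i / 2 powi (m - 1)\<rfloor> div 2 = k $ i"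
      using t floor_powi_pred[of "t $ i" m] by (simp add: mem_dyadic_cube_iff_floor)
    then show "\<lfloor>t $ i / 2 powi (m - 1)\<rfloor> = dyadic_child k e $ i"
      unfolding dyadic_child_def e_def by (simp; presburger)
  qed
  then show "t \<in> (\<Union>e. dyadic_cube (m - 1) (dyadic_child k e))" by blast
next
  fix t assume "t \<in> (\<Union>e. dyadic_cube (m - 1) (dyadic_child k e))"
  then obtain e where "t \<in> dyadic_cube (m - 1) (dyadic_child k e)" by blast
  then show "t \<in> dyadic_cube m k"
    by (auto simp: mem_dyadic_cube_iff_floor floor_powi_pred[of _ m] dyadic_child_def)
qed

lemma dyadic_cube_disjoint: "k \<noteq> l \<Longrightarrow> dyadic_cube m k \<inter> dyadic_cube m l = {}"
  unfolding vec_eq_iff disjoint_iff mem_dyadic_cube_iff_floor by metis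

lemma inj_dyadic_child: "inj (dyadic_child k)"
proof (rule injI)
  fix e e' assume eq: "dyadic_child k e = dyadic_child k e'"
  then have "i \<in> e \<longleftrightarrow> i \<in> e'" for i
    using arg_cong[of _ _ "\<lambda>v. v $ i", OF eq]
    unfolding dyadic_child_def vec_lambda_beta by (simp split: if_splits)
  then show "e = e'" by blast
qed

lemma disjoint_family_children:
  "disjoint_family (\<lambda>e. dyadic_cube (m - 1) (dyadic_child k e))"
  unfolding disjoint_family_on_def
  by (simp add: dyadic_cube_disjoint inj_dyadic_child[THEN inj_eq])

lemma dyadic_child_subset: "dyadic_cube (m - 1) (dyadic_child k e) \<subseteq> dyadic_cube m k"
  using dyadic_cube_eq_Union_children by blast

lemma dyadic_cube_nested:
  assumes "m' \<le> m" "dyadic_cube m' k' \<inter> dyadic_cube m k \<noteq> {}"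
  shows "dyadic_cube m' k' \<subseteq> dyadic_cube m k"
proof -
  have "\<forall>k. dyadic_cube m' k' \<inter> dyadic_cube m k \<noteq> {} \<longrightarrow> dyadic_cube m' k' \<subseteq> dyadic_cube m k"
    using assms(1)
  proof (induction m rule: int_ge_induct)
    case base
    show ?case
    proof (intro allI impI)
      fix k assume "dyadic_cube m' k' \<inter> dyadic_cube m' k \<noteq> {}"
      then have "k' = k" using dyadic_cube_disjoint[of k' k m'] by blast
      then show "dyadic_cube m' k' \<subseteq> dyadic_cube m' k" by simp
    qed
  next
    case (step m)
    show ?case
    proof (intro allI impI)
      fix k assume "dyadic_cube m' k' \<inter> dyadic_cube (m + 1) k \<noteq> {}"
      then obtain e where "dyadic_cube m' k' \<inter> dyadic_cube m (dyadic_child k e) \<noteq> {}"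
        using dyadic_cube_eq_Union_children[of "m + 1" k] by auto
      then show "dyadic_cube m' k' \<subseteq> dyadic_cube (m + 1) k"
        using step.IH dyadic_child_subset[of "m + 1" k e] by fastforce
    qed
  qed
  then show ?thesis using assms(2) by blast
qed

lemma corner_in_dyadic_cube: "(\<chi> i. of_int (k $ i) * 2 powi m) \<in> dyadic_cube m k"
  by (simp add: mem_dyadic_cube_iff_floor)

lemma dyadic_cube_nonempty: "dyadic_cube m k \<noteq> {}"
  using corner_in_dyadic_cube by blast

lemma dyadic_cubes_intro [simp]: "dyadic_cube m k \<in> dyadic_cubes"
  by (auto simp: dyadic_cubes_def)

text \<open>Reduces a condition on all dyadic subcubes to the top cube and to the subcubes of single
  children, as needed when functions are glued.\<close>

lemma dyadic_subcubes_cases: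
  assumes "J \<in> dyadic_subcubes (dyadic_cube m k)"
  obtains "J = dyadic_cube m k"
  | e where "J \<in> dyadic_subcubes (dyadic_cube (m - 1) (dyadic_child k e))"
proof -
  from assms obtain m' k' where J: "J = dyadic_cube m' k'" "J \<subseteq> dyadic_cube m k"
    by (auto simp: dyadic_subcubes_def dyadic_cubes_def)
  show thesis
  proof (cases "m \<le> m'")
    case True
    then have "dyadic_cube m k \<subseteq> J"
      using J dyadic_cube_nested[OF True] dyadic_cube_nonempty[of m' k'] by blast
    then show thesis using J that(1) by blast
  next
    case False
    obtain e where "J \<inter> dyadic_cube (m - 1) (dyadic_child k e) \<noteq> {}"
      using J dyadic_cube_nonempty[of m' k'] dyadic_cube_eq_Union_children[of m k] by blast
    then have "J \<subseteq> dyadic_cube (m - 1) (dyadic_child k e)"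
      using J(1) False dyadic_cube_nested[of m' "m - 1"] by simp
    then show thesis using J(1) that(2) by (auto simp: dyadic_subcubes_def)
  qed
qed

lemma dyadic_subcubes_child:
  "J \<in> dyadic_subcubes (dyadic_cube (m - 1) (dyadic_child k e)) \<Longrightarrow> J \<in> dyadic_subcubes (dyadic_cube m k)"
  using dyadic_child_subset[of m k e] by (auto simp: dyadic_subcubes_def)

lemma dyadic_cube_subcube_self [simp]: "dyadic_cube m k \<in> dyadic_subcubes (dyadic_cube m k)"
  by (auto simp: dyadic_subcubes_def)

section \<open>Measure and averages on dyadic cubes\<close>

lemma
  shows dyadic_cube_lmeasurable: "dyadic_cube m k \<in> lmeasurable"
    and measure_dyadic_cube:
      "measure lebesgue (dyadic_cube m k :: (real ^ 'n) set) = (2 powi m) ^ CARD('n)"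
proof -
  define a b :: "real ^ 'n" where "a = (\<chi> i. of_int (k $ i) * 2 powi m)"
    and "b = (\<chi> i. (of_int (k $ i) + 1) * 2 powi m)"
  \<comment> \<open>The half-open cube lies between the open and the closed box with the same
    corners, which differ only by a negligible frontier.\<close>
  have sub: "box a b \<subseteq> dyadic_cube m k" "dyadic_cube m k \<subseteq> cbox a b"
    by (auto simp: a_def b_def dyadic_cube_def mem_box_cart less_imp_le)
  have "negligible (cbox a b - dyadic_cube m k)"
    using sub(1) by (intro negligible_subset[OF negligible_frontier_interval[of a b]]) auto
  then have neg: "negligible (sym_diff (dyadic_cube m k) (cbox a b))"
    using sub(2) by (metis Diff_eq_empty_iff Un_empty_left)
  show "dyadic_cube m k \<in> lmeasurable"
    using lmeasurable_negligible_symdiff[OF lmeasurable_cbox[of a b], of "dyadic_cube m k"] neg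
    by (simp add: Un_commute)
  have "measure lebesgue (dyadic_cube m k) = measure lebesgue (cbox a b)"
    using measure_negligible_symdiff[OF lmeasurable_cbox[of a b], of "dyadic_cube m k"] neg
    by (simp add: Un_commute)
  also have "\<dots> = (\<Prod>i\<in>(UNIV::'n set). 2 powi m)"
    by (subst measure_completion, simp, subst content_cbox_if_cart)
       (auto simp: interval_eq_empty_cart a_def b_def algebra_simps not_less)
  finally show "measure lebesgue (dyadic_cube m k) = (2 powi m) ^ CARD('n)" by simp
qed

lemma measure_dyadic_cube_pos: "0 < measure lebesgue (dyadic_cube m k)"
  by (simp add: measure_dyadic_cube)

lemma dyadic_cube_sets [measurable]: "dyadic_cube m k \<in> sets lebesgue"
  using dyadic_cube_lmeasurable by blast

lemma measure_child:
  "measure lebesgue (dyadic_cube (m - 1) l :: (real ^ 'n) set)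
     = (1/2) ^ CARD('n) * measure lebesgue (dyadic_cube m k :: (real ^ 'n) set)"
  unfolding measure_dyadic_cube power_mult_distrib[symmetric] by (simp add: power_int_diff)

lemma set_integrable_child:
  "set_integrable lebesgue (dyadic_cube m k) f \<Longrightarrow> set_integrable lebesgue (dyadic_cube (m - 1) (dyadic_child k e)) f"
  for f :: "_ \<Rightarrow> real"
  by (erule set_integrable_subset) (auto simp: dyadic_child_subset)

lemma set_integrable_from_children:
  fixes f :: "_ \<Rightarrow> real"
  assumes "\<And>e. set_integrable lebesgue (dyadic_cube (m - 1) (dyadic_child k e)) f"
  shows "set_integrable lebesgue (dyadic_cube m k) f"
  by (subst dyadic_cube_eq_Union_children, rule set_integrable_UN) (use assms in auto)

lemma avg_children:
  fixes f :: "real ^ 'n \<Rightarrow> real"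
  assumes "set_integrable lebesgue (dyadic_cube m k) f"
  shows "avg (dyadic_cube m k) f =
    (1/2) ^ CARD('n) * (\<Sum>e\<in>UNIV. avg (dyadic_cube (m - 1) (dyadic_child k e)) f)"
proof -
  let ?M = "measure lebesgue (dyadic_cube m k)"
  have "(LINT t:dyadic_cube m k|lebesgue. f t)
      = (\<Sum>e\<in>UNIV. LINT t:dyadic_cube (m - 1) (dyadic_child k e)|lebesgue. f t)"
    by (subst dyadic_cube_eq_Union_children, rule set_integral_finite_Union)
       (use assms in \<open>auto simp: disjoint_family_children intro: set_integrable_child\<close>)
  also have "\<dots> = (\<Sum>e\<in>UNIV. avg (dyadic_cube (m - 1) (dyadic_child k e)) f * ((1/2) ^ CARD('n) * ?M))"
  proof (rule sum.cong)
    fix e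
    show "(LINT t:dyadic_cube (m - 1) (dyadic_child k e)|lebesgue. f t)
        = avg (dyadic_cube (m - 1) (dyadic_child k e)) f * ((1/2) ^ CARD('n) * ?M)"
      unfolding measure_child[of m "dyadic_child k e" k, symmetric]
      using measure_dyadic_cube_pos[of "m - 1" "dyadic_child k e"] by (simp add: avg_def)
  qed simp
  also have "\<dots> = (1/2) ^ CARD('n) * (\<Sum>e\<in>UNIV. avg (dyadic_cube (m - 1) (dyadic_child k e)) f) * ?M"
    by (simp only: sum_distrib_right[symmetric]) (simp only: mult_ac)
  finally show ?thesis
    using measure_dyadic_cube_pos[of m k] by (simp add: avg_def)
qed

lemma avg_add: "set_integrable lebesgue J f \<Longrightarrow> set_integrable lebesgue J g \<Longrightarrow>
    avg J (\<lambda>t. f t + g t) = avg J f + avg J g"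
  by (simp add: avg_def add_divide_distrib)

lemma avg_diff: "set_integrable lebesgue J f \<Longrightarrow> set_integrable lebesgue J g \<Longrightarrow>
    avg J (\<lambda>t. f t - g t) = avg J f - avg J g"
  by (simp add: avg_def diff_divide_distrib)

lemma avg_mult: "avg J (\<lambda>t. c * f t) = c * avg J f"
  by (simp add: avg_def)

lemma set_integrable_const: "set_integrable lebesgue (dyadic_cube m k) (\<lambda>t. c :: real)"
  using dyadic_cube_lmeasurable[of m k]
  by (auto simp: set_integrable_def fmeasurable_def)

lemma avg_const: "avg (dyadic_cube m k) (\<lambda>t. c) = c"
  using dyadic_cube_lmeasurable[of m k] measure_dyadic_cube_pos[of m k]
  by (simp add: avg_def set_lebesgue_integral_def fmeasurable_def)

lemma avg_mono: "set_integrable lebesgue J f \<Longrightarrow> set_integrable lebesgue J g \<Longrightarrow>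
    (\<And>t. t \<in> J \<Longrightarrow> f t \<le> g t) \<Longrightarrow> avg J f \<le> avg J g"
  unfolding avg_def by (intro divide_right_mono set_integral_mono) auto

lemma avg_cong: "J \<in> sets lebesgue \<Longrightarrow> (\<And>t. t \<in> J \<Longrightarrow> f t = g t) \<Longrightarrow> avg J f = avg J g"
  unfolding avg_def using set_lebesgue_integral_cong[of J lebesgue f g] by simp

lemma abs_avg_le: "set_integrable lebesgue J f \<Longrightarrow> \<bar>avg J f\<bar> \<le> avg J (\<lambda>t. \<bar>f t\<bar>)"
  using avg_mono[of J f "\<lambda>t. \<bar>f t\<bar>"] avg_mono[of J "\<lambda>t. -1 * f t" "\<lambda>t. \<bar>f t\<bar>"]
    set_integrable_abs[of lebesgue J f] set_integrable_mult_right[of "-1" lebesgue J f]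
  unfolding avg_mult by (simp add: abs_le_iff)

lemma sum_children_const: "(1/2 :: real) ^ CARD('n::finite) * (\<Sum>e\<in>(UNIV::'n set set). c) = c"
proof -
  have "card (UNIV::'n set set) = 2 ^ CARD('n)" 
    using card_Pow[of "UNIV::'n set"] by simp
  then show ?thesis by (simp add: power_one_over)
qed

subsection \<open>Variances\<close>

lemma set_integral_dominated_to_0:
  fixes u :: "nat \<Rightarrow> 'a::euclidean_space \<Rightarrow> real"
  assumes [measurable]: "\<And>n. u n \<in> borel_measurable lebesgue" "Q \<in> sets lebesgue"
    and w: "set_integrable lebesgue Q w" and bound: "\<And>n t. t \<in> Q \<Longrightarrow> \<bar>u n t\<bar> \<le> w t"
    and lim: "AE t in lebesgue. t \<in> Q \<longrightarrow> (\<lambda>n. u n t) \<longlonglongrightarrow> 0"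
  shows "set_integrable lebesgue Q (u n)" "(\<lambda>n. LINT t:Q|lebesgue. u n t) \<longlonglongrightarrow> 0"
proof -
  have l: "AE t in lebesgue. (\<lambda>n. indicator Q t *\<^sub>R u n t) \<longlonglongrightarrow> 0"
    using lim by eventually_elim (auto simp: indicator_def)
  have b: "AE t in lebesgue. norm (indicator Q t *\<^sub>R u n t) \<le> indicator Q t *\<^sub>R w t" for n
    using bound by (auto simp: indicator_def)
  show "set_integrable lebesgue Q (u n)"
    unfolding set_integrable_def
    by (rule integrable_dominated_convergence2[OF _ _ w[unfolded set_integrable_def] l b]) auto
  have "(\<lambda>n. LINT t|lebesgue. indicator Q t *\<^sub>R u n t) \<longlonglongrightarrow> (LINT t|(lebesgue :: 'a measure). (0::real))"
    by (rule integral_dominated_convergence[OF _ _ w[unfolded set_integrable_def] l b]) auto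
  then show "(\<lambda>n. LINT t:Q|lebesgue. u n t) \<longlonglongrightarrow> 0"
    by (simp add: set_lebesgue_integral_def)
qed

lemma square_add_le: "(a + b)\<^sup>2 \<le> 2 * a\<^sup>2 + 2 * b\<^sup>2" for a b :: real
  using sum_squares_bound[of a b] by (simp add: power2_sum)

text \<open>First truncate \<open>f\<close> at a height \<open>M\<close>, then take continuous
  functions converging to \<open>f\<close> almost everywhere and truncate them at the same height.
  Dominated convergence controls both steps, with dominating functions \<open>(f t)\<^sup>2\<close>
  and a constant.\<close>

lemma square_integrable_continuous_approx:
  fixes f :: "'a::euclidean_space \<Rightarrow> real"
  assumes [measurable]: "f \<in> borel_measurable lebesgue" and Q: "Q \<in> lmeasurable"
    and f2: "set_integrable lebesgue Q (\<lambda>t. (f t)\<^sup>2)" and "0 < e"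
  obtains g where "continuous_on UNIV g" "set_integrable lebesgue Q (\<lambda>t. (f t - g t)\<^sup>2)"
    "(LINT t:Q|lebesgue. (f t - g t)\<^sup>2) < e"
proof -
  have [measurable]: "Q \<in> sets lebesgue" using Q by blast
  define clip :: "real \<Rightarrow> real \<Rightarrow> real" where "clip M y = max (-M) (min M y)" for M y
  have clip_abs: "\<bar>clip M y\<bar> \<le> M" if "0 \<le> M" for M y using that by (auto simp: clip_def)
  define u where "u n t = (f t - clip (real n) (f t))\<^sup>2" for n t
  have um [measurable]: "u n \<in> borel_measurable lebesgue" for n
    unfolding u_def clip_def by measurable
  have ub: "\<bar>u n t\<bar> \<le> (f t)\<^sup>2" for n t
    unfolding u_def abs_power2 by (rule abs_le_square_iff[THEN iffD1]) (auto simp: clip_def)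
  have ul: "(\<lambda>n. u n t) \<longlonglongrightarrow> 0" for t
  proof (rule tendsto_eventually)
    obtain N where "\<bar>f t\<bar> \<le> real N" using real_arch_simple by blast
    then show "\<forall>\<^sub>F n in sequentially. u n t = 0"
      by (intro eventually_sequentiallyI[of N]) (auto simp: u_def clip_def)
  qed
  have u: "set_integrable lebesgue Q (u n)" "(\<lambda>n. LINT t:Q|lebesgue. u n t) \<longlonglongrightarrow> 0" for n
    using set_integral_dominated_to_0[of u Q "\<lambda>t. (f t)\<^sup>2"] um f2 ub ul by auto
  \<comment> \<open>Each of the two errors gets a quarter of \<open>e\<close>, because
    \<open>square_add_le\<close> doubles both.\<close>
  obtain M where M: "(LINT t:Q|lebesgue. u M t) < e / 4"
    using order_tendstoD(2)[OF u(2), of "e / 4"] \<open>0 < e\<close> by (auto simp: eventually_sequentially)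
  define p where "p t = clip (real M) (f t)" for t
  have pm [measurable]: "p \<in> borel_measurable lebesgue" unfolding p_def clip_def by measurable
  have "f measurable_on UNIV" by (intro lebesgue_measurable_imp_measurable_on) auto
  then obtain N h where N: "negligible N" and h: "\<And>n. continuous_on UNIV (h n)"
      "\<And>t. t \<notin> N \<Longrightarrow> (\<lambda>n. h n t) \<longlonglongrightarrow> f t"
    unfolding measurable_on_def by auto
  define g where "g n t = clip (real M) (h n t)" for n t
  have gc: "continuous_on UNIV (g n)" for n
    unfolding g_def clip_def by (intro continuous_intros h)
  have [measurable]: "g n \<in> borel_measurable lebesgue" for n
    using borel_measurable_continuous_onI[OF gc[of n]] by (intro measurable_completion) simp
  define v where "v n t = (p t - g n t)\<^sup>2" for n t
  have vm [measurable]: "v n \<in> borel_measurable lebesgue" for n unfolding v_def by measurable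
  have vb: "\<bar>v n t\<bar> \<le> (2 * real M)\<^sup>2" for n t
    unfolding v_def abs_power2
    using clip_abs[of "real M" "f t"] clip_abs[of "real M" "h n t"]
    by (intro abs_le_square_iff[THEN iffD1]) (auto simp: p_def g_def)
  have vl: "AE t in lebesgue. t \<in> Q \<longrightarrow> (\<lambda>n. v n t) \<longlonglongrightarrow> 0"
  proof (rule AE_I')
    show "N \<in> null_sets lebesgue" using N by (simp add: negligible_iff_null_sets)
    show "{t \<in> space lebesgue. \<not> (t \<in> Q \<longrightarrow> (\<lambda>n. v n t) \<longlonglongrightarrow> 0)} \<subseteq> N"
    proof clarsimp
      fix t assume t: "\<not> (\<lambda>n. v n t) \<longlonglongrightarrow> 0"
      show "t \<in> N"
      proof (rule ccontr)
        assume "t \<notin> N"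
        then have "(\<lambda>n. v n t) \<longlonglongrightarrow> (p t - clip (real M) (f t))\<^sup>2"
          unfolding v_def g_def clip_def by (intro tendsto_intros h)
        then show False using t by (simp add: p_def)
      qed
    qed
  qed
  have "set_integrable lebesgue Q (\<lambda>t. (2 * real M)\<^sup>2)"
    using Q by (auto simp: set_integrable_def fmeasurable_def)
  then have v: "set_integrable lebesgue Q (v n)" "(\<lambda>n. LINT t:Q|lebesgue. v n t) \<longlonglongrightarrow> 0" for n
    using set_integral_dominated_to_0[of v Q "\<lambda>t. (2 * real M)\<^sup>2"] vm vb vl by auto
  obtain n where n: "(LINT t:Q|lebesgue. v n t) < e / 4"
    using order_tendstoD(2)[OF v(2), of "e / 4"] \<open>0 < e\<close> by (auto simp: eventually_sequentially)
  have le: "(f t - g n t)\<^sup>2 \<le> 2 * u M t + 2 * v n t" for t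
    using square_add_le[of "f t - p t" "p t - g n t"] by (simp add: u_def v_def p_def)
  have int: "set_integrable lebesgue Q (\<lambda>t. 2 * u M t + 2 * v n t)"
    using u v by auto
  have fg: "set_integrable lebesgue Q (\<lambda>t. (f t - g n t)\<^sup>2)"
    using le by (intro set_integrable_bound[OF int]) (auto simp: set_borel_measurable_def u_def v_def)
  have "(LINT t:Q|lebesgue. (f t - g n t)\<^sup>2) \<le> (LINT t:Q|lebesgue. 2 * u M t + 2 * v n t)"
    by (rule set_integral_mono[OF fg int le])
  also have "\<dots> < e" using u v M n by simp
  finally show thesis using that gc fg by blast
qed

section \<open>Variance and the BMO condition\<close>

lemma set_integrable_minus_const_square_iff:
  fixes \<phi> :: "_ \<Rightarrow> real"
  assumes "set_integrable lebesgue (dyadic_cube m k) \<phi>"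
  shows "set_integrable lebesgue (dyadic_cube m k) (\<lambda>t. \<bar>\<phi> t - a\<bar>\<^sup>2)
    \<longleftrightarrow> set_integrable lebesgue (dyadic_cube m k) (\<lambda>t. (\<phi> t)\<^sup>2)"
proof
  let ?I = "set_integrable lebesgue (dyadic_cube m k)"
  have lin: "?I (\<lambda>t. 2 * a * \<phi> t)" "?I (\<lambda>t. a\<^sup>2)"
    using assms set_integrable_const by auto
  have 1: "(\<lambda>t. (\<phi> t)\<^sup>2) = (\<lambda>t. \<bar>\<phi> t - a\<bar>\<^sup>2 + 2 * a * \<phi> t - a\<^sup>2)"
    and 2: "(\<lambda>t. \<bar>\<phi> t - a\<bar>\<^sup>2) = (\<lambda>t. (\<phi> t)\<^sup>2 - 2 * a * \<phi> t + a\<^sup>2)"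
    by (auto simp: power2_diff)
  show "?I (\<lambda>t. \<bar>\<phi> t - a\<bar>\<^sup>2) \<Longrightarrow> ?I (\<lambda>t. (\<phi> t)\<^sup>2)"
    unfolding 1 by (intro set_integral_add set_integral_diff lin)
  show "?I (\<lambda>t. (\<phi> t)\<^sup>2) \<Longrightarrow> ?I (\<lambda>t. \<bar>\<phi> t - a\<bar>\<^sup>2)"
    unfolding 2 by (intro set_integral_add set_integral_diff lin)
qed

lemma avg_minus_const_square:
  assumes "set_integrable lebesgue (dyadic_cube m k) \<phi>"
    "set_integrable lebesgue (dyadic_cube m k) (\<lambda>t. (\<phi> t)\<^sup>2)"
  shows "avg (dyadic_cube m k) (\<lambda>t. \<bar>\<phi> t - a\<bar>\<^sup>2)
    = avg (dyadic_cube m k) (\<lambda>t. (\<phi> t)\<^sup>2) - 2 * a * avg (dyadic_cube m k) \<phi> + a\<^sup>2"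
proof -
  have "(\<lambda>t. \<bar>\<phi> t - a\<bar>\<^sup>2) = (\<lambda>t. (\<phi> t)\<^sup>2 - 2 * a * \<phi> t + a\<^sup>2)"
    by (auto simp: power2_diff)
  then show ?thesis
    using assms set_integrable_const[of m k "a\<^sup>2"]
    by (simp only: avg_add avg_diff set_integral_diff set_integrable_mult_right avg_mult avg_const)
qed

lemma avg_nonneg: "(\<And>t. 0 \<le> f t) \<Longrightarrow> 0 \<le> avg J f"
  unfolding avg_def set_lebesgue_integral_def by (simp add: integral_nonneg_AE)

definition variance :: "(real ^ 'n) set \<Rightarrow> (real ^ 'n \<Rightarrow> real) \<Rightarrow> real" where
  "variance J \<phi> = avg J (\<lambda>t. (\<phi> t)\<^sup>2) - (avg J \<phi>)\<^sup>2"

lemma avg_oscillation: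
  assumes "set_integrable lebesgue (dyadic_cube m k) \<phi>"
    "set_integrable lebesgue (dyadic_cube m k) (\<lambda>t. (\<phi> t)\<^sup>2)"
  shows "avg (dyadic_cube m k) (\<lambda>t. \<bar>\<phi> t - avg (dyadic_cube m k) \<phi>\<bar>\<^sup>2) = variance (dyadic_cube m k) \<phi>"
  using avg_minus_const_square[OF assms] by (simp add: variance_def power2_eq_square del: power2_abs)

lemma variance_nonneg:
  assumes "set_integrable lebesgue (dyadic_cube m k) \<phi>"
    "set_integrable lebesgue (dyadic_cube m k) (\<lambda>t. (\<phi> t)\<^sup>2)"
  shows "0 \<le> variance (dyadic_cube m k) \<phi>"
  by (subst avg_oscillation[OF assms, symmetric]) (rule avg_nonneg, simp)

text \<open>The mean is the constant closest to \<open>\<phi>\<close> in mean square. In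
  \<open>residual_le\<close> this allows the mean to be replaced by a value of the approximating
  function.\<close>

lemma variance_le:
  assumes "set_integrable lebesgue (dyadic_cube m k) \<phi>"
    "set_integrable lebesgue (dyadic_cube m k) (\<lambda>t. (\<phi> t)\<^sup>2)"
  shows "variance (dyadic_cube m k) \<phi> \<le> avg (dyadic_cube m k) (\<lambda>t. \<bar>\<phi> t - a\<bar>\<^sup>2)"
  using zero_le_power2[of "avg (dyadic_cube m k) \<phi> - a"] unfolding avg_minus_const_square[OF assms] variance_def
  by (simp add: power2_diff algebra_simps)

text \<open>The working form of the definition: the oscillation becomes a difference of the first
  two moments, which are exactly the coordinates of the Bellman point. The sign of
  \<open>\<epsilon>\<close> matters when the square root is removed.\<close>

lemma mem_BMO_dyadic_iff:
  assumes "0 \<le> \<epsilon>"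
  shows "\<phi> \<in> BMO_dyadic \<epsilon> (dyadic_cube m k) \<longleftrightarrow>
    set_integrable lebesgue (dyadic_cube m k) \<phi> \<and>
    set_integrable lebesgue (dyadic_cube m k) (\<lambda>t. (\<phi> t)\<^sup>2) \<and>
    (\<forall>J\<in>dyadic_subcubes (dyadic_cube m k). variance J \<phi> \<le> \<epsilon>\<^sup>2)"
    (is "?L \<longleftrightarrow> ?R")
proof -
  let ?Q = "dyadic_cube m k"
  have *: "set_integrable lebesgue J f"
    if "J \<in> dyadic_subcubes ?Q" "set_integrable lebesgue ?Q f" for J and f :: "_ \<Rightarrow> real"
    using that by (auto simp: dyadic_subcubes_def dyadic_cubes_def elim!: set_integrable_subset)
  have **: "avg J (\<lambda>t. \<bar>\<phi> t - avg J \<phi>\<bar>\<^sup>2) = variance J \<phi>"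
    if "J \<in> dyadic_subcubes ?Q" "set_integrable lebesgue ?Q \<phi>" "set_integrable lebesgue ?Q (\<lambda>t. (\<phi> t)\<^sup>2)" for J
  proof -
    note J = that
    obtain m' k' where "J = dyadic_cube m' k'"
      using J(1) by (auto simp: dyadic_subcubes_def dyadic_cubes_def)
    then show ?thesis using *[OF J(1)] J avg_oscillation by blast
  qed
  have sq: "ereal (sqrt v) \<le> ereal \<epsilon> \<longleftrightarrow> v \<le> \<epsilon>\<^sup>2" for v
    using assms real_sqrt_le_mono[of v "\<epsilon>\<^sup>2"] sqrt_le_D[of v \<epsilon>] by auto
  show ?thesis
  proof
    assume L: ?L
    then have i: "set_integrable lebesgue ?Q \<phi>" "set_integrable lebesgue ?Q (\<lambda>t. (\<phi> t)\<^sup>2)"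
      using set_integrable_minus_const_square_iff dyadic_cube_subcube_self[of m k]
      unfolding BMO_dyadic_def by blast+
    moreover have "variance J \<phi> \<le> \<epsilon>\<^sup>2" if "J \<in> dyadic_subcubes ?Q" for J
    proof -
      have "avg J (\<lambda>t. \<bar>\<phi> t - avg J \<phi>\<bar>\<^sup>2) \<le> \<epsilon>\<^sup>2"
        using L that unfolding BMO_dyadic_def by (simp add: SUP_le_iff sq del: ereal_less_eq power2_abs)
      then show ?thesis by (simp only: **[OF that i])
    qed
    ultimately show ?R by blast
  next
    assume R: ?R
    have "set_integrable lebesgue J (\<lambda>t. \<bar>\<phi> t - avg J \<phi>\<bar>\<^sup>2)" if "J \<in> dyadic_subcubes ?Q" for J
    proof -
      note J = that
      obtain m' k' where mk: "J = dyadic_cube m' k'"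
        using J by (auto simp: dyadic_subcubes_def dyadic_cubes_def)
      show ?thesis
        using *[OF J] R unfolding mk by (subst set_integrable_minus_const_square_iff) auto
    qed
    then show ?L
      using R unfolding BMO_dyadic_def by (simp add: SUP_le_iff **[simplified] sq del: ereal_less_eq)
  qed
qed

subsection \<open>The lower bound\<close>

text \<open>The mean square distance of \<open>\<phi>\<close> from its conditional expectation on the \<open>d\<close>-th generation of
  subcubes.\<close>

primrec residual :: "nat \<Rightarrow> int \<Rightarrow> int ^ 'n \<Rightarrow> (real ^ 'n \<Rightarrow> real) \<Rightarrow> real" where
  "residual 0 m k \<phi> = variance (dyadic_cube m k) \<phi>"
| "residual (Suc d) m k \<phi> =
    (1/2) ^ CARD('n) * (\<Sum>e\<in>UNIV. residual d (m - 1) (dyadic_child k e) \<phi>)"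

lemma residual_nonneg:
  assumes "set_integrable lebesgue (dyadic_cube m k) \<phi>"
    "set_integrable lebesgue (dyadic_cube m k) (\<lambda>t. (\<phi> t)\<^sup>2)"
  shows "0 \<le> residual d m k \<phi>"
  using assms
proof (induction d arbitrary: m k)
  case 0
  then show ?case by (simp add: variance_nonneg)
next
  case (Suc d)
  then show ?case by (auto intro!: mult_nonneg_nonneg sum_nonneg Suc.IH set_integrable_child)
qed

text \<open>On a cube of the last generation compare \<open>\<phi>\<close> with one value of
  \<open>g\<close> and split the difference as (\<open>\<phi>\<close> - \<open>g\<close>) plus the
  oscillation of \<open>g\<close>; averaging over the children carries the bound upwards. The
  oscillation hypothesis refers to the absolute scale \<open>m - int d\<close>, so it passes to the
  children unchanged.\<close>

lemma residual_le:
  fixes \<phi> g :: "real ^ 'n \<Rightarrow> real"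
  assumes "set_integrable lebesgue (dyadic_cube m k) \<phi>"
    "set_integrable lebesgue (dyadic_cube m k) (\<lambda>t. (\<phi> t)\<^sup>2)"
    "set_integrable lebesgue (dyadic_cube m k) (\<lambda>t. (\<phi> t - g t)\<^sup>2)"
    and osc: "\<And>l t u. t \<in> dyadic_cube m k \<inter> dyadic_cube (m - int d) l \<Longrightarrow>
      u \<in> dyadic_cube m k \<inter> dyadic_cube (m - int d) l \<Longrightarrow> \<bar>g t - g u\<bar> \<le> \<delta>"
  shows "residual d m k \<phi> \<le> 2 * avg (dyadic_cube m k) (\<lambda>t. (\<phi> t - g t)\<^sup>2) + 2 * \<delta>\<^sup>2"
  using assms
proof (induction d arbitrary: m k)
  case 0
  obtain u where u: "u \<in> dyadic_cube m k" using dyadic_cube_nonempty by blast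
  have "variance (dyadic_cube m k) \<phi> \<le> avg (dyadic_cube m k) (\<lambda>t. \<bar>\<phi> t - g u\<bar>\<^sup>2)"
    using 0 by (intro variance_le) auto
  also have "\<dots> \<le> avg (dyadic_cube m k) (\<lambda>t. 2 * (\<phi> t - g t)\<^sup>2 + 2 * \<delta>\<^sup>2)"
  proof (rule avg_mono)
    show "set_integrable lebesgue (dyadic_cube m k) (\<lambda>t. \<bar>\<phi> t - g u\<bar>\<^sup>2)"
      using 0 by (subst set_integrable_minus_const_square_iff) auto
    show "set_integrable lebesgue (dyadic_cube m k) (\<lambda>t. 2 * (\<phi> t - g t)\<^sup>2 + 2 * \<delta>\<^sup>2)"
      using 0 set_integrable_const[of m k "2 * \<delta>\<^sup>2"] by auto
    fix t assume t: "t \<in> dyadic_cube m k"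
    have "(g t - g u)\<^sup>2 \<le> \<delta>\<^sup>2"
      using "0.prems"(4)[of t k u] t u by (simp add: abs_le_square_iff[symmetric])
    then show "\<bar>\<phi> t - g u\<bar>\<^sup>2 \<le> 2 * (\<phi> t - g t)\<^sup>2 + 2 * \<delta>\<^sup>2"
      using square_add_le[of "\<phi> t - g t" "g t - g u"] by simp
  qed
  also have "\<dots> = 2 * avg (dyadic_cube m k) (\<lambda>t. (\<phi> t - g t)\<^sup>2) + 2 * \<delta>\<^sup>2"
    using 0 set_integrable_const[of m k "2 * \<delta>\<^sup>2"] by (simp add: avg_add avg_mult avg_const)
  finally show ?case by simp
next
  case (Suc d)
  have "residual d (m - 1) (dyadic_child k e) \<phi>
      \<le> 2 * avg (dyadic_cube (m - 1) (dyadic_child k e)) (\<lambda>t. (\<phi> t - g t)\<^sup>2) + 2 * \<delta>\<^sup>2" for e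
  proof (rule Suc.IH)
    fix l t u
    assume "t \<in> dyadic_cube (m - 1) (dyadic_child k e) \<inter> dyadic_cube (m - 1 - int d) l"
      "u \<in> dyadic_cube (m - 1) (dyadic_child k e) \<inter> dyadic_cube (m - 1 - int d) l"
    then show "\<bar>g t - g u\<bar> \<le> \<delta>"
      using dyadic_child_subset[of m k e] by (intro Suc.prems(4)[of t l u]) (auto simp: algebra_simps)
  qed (use Suc.prems set_integrable_child in blast)+
  then have "residual (Suc d) m k \<phi> \<le> (1/2) ^ CARD('n) * (\<Sum>e\<in>UNIV.
      2 * avg (dyadic_cube (m - 1) (dyadic_child k e)) (\<lambda>t. (\<phi> t - g t)\<^sup>2) + 2 * \<delta>\<^sup>2)"
    by (auto intro!: mult_left_mono sum_mono)
  also have "\<dots> = 2 * ((1/2) ^ CARD('n) * (\<Sum>e\<in>UNIV. avg (dyadic_cube (m - 1) (dyadic_child k e)) (\<lambda>t. (\<phi> t - g t)\<^sup>2)))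
       + (1/2) ^ CARD('n) * (\<Sum>e\<in>(UNIV::'n set set). 2 * \<delta>\<^sup>2)"
    unfolding sum.distrib sum_distrib_left[symmetric] distrib_left by (simp only: mult_ac)
  also have "\<dots> = 2 * avg (dyadic_cube m k) (\<lambda>t. (\<phi> t - g t)\<^sup>2) + 2 * \<delta>\<^sup>2"
    unfolding sum_children_const avg_children[OF Suc.prems(3)] ..
  finally show ?case .
qed

lemma dist_le_dyadic_cube:
  fixes t u :: "real ^ 'n"
  assumes "t \<in> dyadic_cube m k" "u \<in> dyadic_cube m k"
  shows "dist t u \<le> real CARD('n) * 2 powi m"
proof -
  have "\<bar>(t - u) $ i\<bar> \<le> 2 powi m" for i
    using assms by (auto simp: dyadic_cube_def abs_le_iff algebra_simps dest!: spec[of _ i])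
  then have "(\<Sum>i\<in>UNIV. \<bar>(t - u) $ i\<bar>) \<le> (\<Sum>i\<in>(UNIV::'n set). 2 powi m)"
    by (intro sum_mono)
  then show ?thesis
    using norm_le_l1_cart[of "t - u"] by (simp add: dist_norm)
qed

lemma bounded_dyadic_cube: "bounded (dyadic_cube m k)"
proof -
  obtain t where "t \<in> dyadic_cube m k" using dyadic_cube_nonempty by blast
  then show ?thesis
    unfolding bounded_def using dist_le_dyadic_cube by blast
qed

text \<open>Approximate \<open>\<phi>\<close> by a continuous \<open>g\<close>, which is uniformly
  continuous on the compact closure of the cube, and choose \<open>d\<close> so large that
  \<open>g\<close> hardly varies on subcubes of generation \<open>d\<close>.\<close>

lemma residual_small:
  fixes \<phi> :: "real ^ 'n \<Rightarrow> real"
  assumes int: "set_integrable lebesgue (dyadic_cube m k) \<phi>"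
    "set_integrable lebesgue (dyadic_cube m k) (\<lambda>t. (\<phi> t)\<^sup>2)" and "0 < e"
  shows "\<exists>d. residual d m k \<phi> < e"
proof -
  \<comment> \<open>Integrability on the cube gives measurability only of the function cut off
    outside it, so the approximation is applied to \<open>?f\<close>.\<close>
  let ?Q = "dyadic_cube m k" and ?f = "\<lambda>t. indicator (dyadic_cube m k) t *\<^sub>R \<phi> t"
  let ?M = "measure lebesgue ?Q"
  have Mpos: "0 < ?M" by (rule measure_dyadic_cube_pos)
  have fm: "?f \<in> borel_measurable lebesgue"
    using int(1) unfolding set_integrable_def by (rule borel_measurable_integrable)
  have f2: "set_integrable lebesgue ?Q (\<lambda>t. (?f t)\<^sup>2)"
    using int(2) by (subst set_integrable_cong[OF refl refl]) auto
  have "0 < e / 4 * ?M" using Mpos \<open>0 < e\<close> by simp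
  then obtain g where g: "continuous_on UNIV g" "set_integrable lebesgue ?Q (\<lambda>t. (?f t - g t)\<^sup>2)"
    "(LINT t:?Q|lebesgue. (?f t - g t)\<^sup>2) < e / 4 * ?M"
    using square_integrable_continuous_approx[OF fm dyadic_cube_lmeasurable f2] by blast
  have gi: "set_integrable lebesgue ?Q (\<lambda>t. (\<phi> t - g t)\<^sup>2)"
    using g(2) by (subst set_integrable_cong[OF refl refl]) auto
  have "(LINT t:?Q|lebesgue. (?f t - g t)\<^sup>2) = (LINT t:?Q|lebesgue. (\<phi> t - g t)\<^sup>2)"
    by (rule set_lebesgue_integral_cong) auto
  then have ga: "avg ?Q (\<lambda>t. (\<phi> t - g t)\<^sup>2) < e / 4"
    using g(3) Mpos by (simp add: avg_def pos_divide_less_eq)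
  \<comment> \<open>With this choice the second term in \<open>residual_le\<close> is
    \<open>e / 2\<close>, and the first is strictly below \<open>e / 2\<close>.\<close>
  define \<delta> where "\<delta> = sqrt (e / 4)"
  have \<delta>: "0 < \<delta>" "\<delta>\<^sup>2 = e / 4" using \<open>0 < e\<close> by (auto simp: \<delta>_def)
  have "?Q \<subseteq> closure ?Q" "compact (closure ?Q)"
    using bounded_dyadic_cube[of m k] closure_subset by (auto simp: compact_closure)
  then have "uniformly_continuous_on (closure ?Q) g"
    using g(1) continuous_on_subset by (blast intro: compact_uniformly_continuous)
  then have "uniformly_continuous_on ?Q g"
    using closure_subset[of ?Q] unfolding uniformly_continuous_on_def by (meson subsetD)
  then obtain r where r: "0 < r"
    "\<And>t u. t \<in> ?Q \<Longrightarrow> u \<in> ?Q \<Longrightarrow> dist u t < r \<Longrightarrow> dist (g u) (g t) < \<delta>"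
    unfolding uniformly_continuous_on_def using \<delta>(1) by blast
  have "(\<lambda>d. real CARD('n) * 2 powi m * (1/2) ^ d) \<longlonglongrightarrow> real CARD('n) * 2 powi m * 0"
    by (intro tendsto_intros LIMSEQ_power_zero) auto
  then have "\<forall>\<^sub>F d in sequentially. real CARD('n) * 2 powi m * (1/2) ^ d < r"
    using r(1) by (intro order_tendstoD(2)) auto
  then obtain d where d: "real CARD('n) * 2 powi m * (1/2) ^ d < r"
    by (auto simp: eventually_sequentially)
  have pd: "(2::real) powi (m - int d) = 2 powi m * (1/2) ^ d"
    by (simp add: power_int_diff power_divide)
  have "residual d m k \<phi> \<le> 2 * avg ?Q (\<lambda>t. (\<phi> t - g t)\<^sup>2) + 2 * \<delta>\<^sup>2"
  proof (rule residual_le[OF int gi])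
    fix l t u
    assume tu: "t \<in> ?Q \<inter> dyadic_cube (m - int d) l" "u \<in> ?Q \<inter> dyadic_cube (m - int d) l"
    then have "dist u t < r"
      using dist_le_dyadic_cube[of u "m - int d" l t] d unfolding pd by (simp add: mult.assoc)
    then show "\<bar>g t - g u\<bar> \<le> \<delta>"
      using r(2)[of t u] tu by (simp add: dist_real_def abs_minus_commute)
  qed
  also have "\<dots> < e" using ga \<delta>(2) by simp
  finally show ?thesis by blast
qed

text \<open>Induction on the number of generations. Only when all children have means of modulus at
  most \<open>q\<close> is the induction hypothesis used; otherwise the estimate holds at once, and
  the nonnegative residual is merely added.\<close>

lemma avg_square_le_residual:
  fixes \<phi> :: "real ^ 'n \<Rightarrow> real" and s q :: real
  assumes int: "set_integrable lebesgue (dyadic_cube m k) \<phi>"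
    "set_integrable lebesgue (dyadic_cube m k) (\<lambda>t. (\<phi> t)\<^sup>2)"
    and var: "\<forall>J\<in>dyadic_subcubes (dyadic_cube m k). variance J \<phi> \<le> s * q"
    and sq: "0 < q" "s = (1/2) ^ CARD('n) * q"
    and mean: "\<bar>avg (dyadic_cube m k) \<phi>\<bar> \<le> q"
  shows "avg (dyadic_cube m k) (\<lambda>t. (\<phi> t)\<^sup>2)
    \<le> (s + q) * avg (dyadic_cube m k) (\<lambda>t. \<bar>\<phi> t\<bar>) + residual d m k \<phi>"
  using int var mean
proof (induction d arbitrary: m k)
  case 0
  define p where "p = \<bar>avg (dyadic_cube m k) \<phi>\<bar>"
  have "p\<^sup>2 \<le> (s + q) * p"
    using 0(4) sq unfolding p_def power2_eq_square
    by (intro mult_right_mono) (auto intro: add_increasing)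
  also have "\<dots> \<le> (s + q) * avg (dyadic_cube m k) (\<lambda>t. \<bar>\<phi> t\<bar>)"
    using abs_avg_le[OF 0(1)] sq unfolding p_def by (intro mult_left_mono) auto
  finally show ?case by (simp add: variance_def p_def)
next
  case (Suc d)
  let ?Q = "dyadic_cube m k" and ?C = "\<lambda>e. dyadic_cube (m - 1) (dyadic_child k e)"
    and ?\<alpha> = "(1/2::real) ^ CARD('n)"
  define p where "p = \<bar>avg ?Q \<phi>\<bar>"
  define A where "A = avg ?Q (\<lambda>t. \<bar>\<phi> t\<bar>)"
  have pA: "p \<le> A" using abs_avg_le Suc.prems(1) by (auto simp: p_def A_def)
  have "0 < s" using sq by simp
  have X: "avg ?Q (\<lambda>t. (\<phi> t)\<^sup>2) \<le> p\<^sup>2 + s * q"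
    using bspec[OF Suc.prems(3) dyadic_cube_subcube_self] by (simp add: variance_def p_def)
  have res: "0 \<le> residual (Suc d) m k \<phi>"
    by (rule residual_nonneg[OF Suc.prems(1,2)])
  consider "s \<le> p" | "p < s" "\<exists>e. q < \<bar>avg (?C e) \<phi>\<bar>" | "\<forall>e. \<bar>avg (?C e) \<phi>\<bar> \<le> q"
    by (meson not_le)
  then show ?case
  proof cases
    case 1
    have "0 \<le> (p - s) * (q - p)" using 1 Suc.prems(4) by (auto simp: p_def)
    then have "p\<^sup>2 + s * q \<le> (s + q) * p" by (simp add: algebra_simps power2_eq_square)
    also have "\<dots> \<le> (s + q) * A" using pA sq \<open>0 < s\<close> by (intro mult_left_mono) auto
    finally show ?thesis using X res by (simp add: A_def)
  next
    case 2
    then obtain e where e: "q < \<bar>avg (?C e) \<phi>\<bar>" by blast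
    \<comment> \<open>The large child contributes at least \<open>s\<close> to the mean in modulus,
      while the total has modulus \<open>p < s\<close>. The other children must cancel the excess,
      contributing at least \<open>s - p\<close>, whence \<open>2 * s - p \<le> A\<close>.\<close>
    let ?r = "\<Sum>e'\<in>UNIV - {e}. avg (?C e') \<phi>"
    have "avg ?Q \<phi> = ?\<alpha> * (avg (?C e) \<phi> + ?r)"
      unfolding avg_children[OF Suc.prems(1)] by (subst sum.remove[of _ e]) auto
    moreover have "\<bar>avg (?C e) \<phi>\<bar> + \<bar>?r\<bar> \<le> (\<Sum>e'\<in>UNIV. \<bar>avg (?C e') \<phi>\<bar>)"
      by (subst sum.remove[of _ e]) auto
    then have "?\<alpha> * (\<bar>avg (?C e) \<phi>\<bar> + \<bar>?r\<bar>) \<le> ?\<alpha> * (\<Sum>e'\<in>UNIV. avg (?C e') (\<lambda>t. \<bar>\<phi> t\<bar>))"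
      by (intro mult_left_mono) (auto elim!: order_trans
          intro!: sum_mono abs_avg_le set_integrable_child[OF Suc.prems(1)])
    then have "?\<alpha> * \<bar>avg (?C e) \<phi>\<bar> + ?\<alpha> * \<bar>?r\<bar> \<le> A"
      unfolding A_def avg_children[OF set_integrable_abs[OF Suc.prems(1)]] by (simp add: distrib_left)
    moreover have "s \<le> ?\<alpha> * \<bar>avg (?C e) \<phi>\<bar>" using e sq(2) by simp
    moreover have "?\<alpha> * \<bar>avg (?C e) \<phi>\<bar> = \<bar>?\<alpha> * avg (?C e) \<phi>\<bar>" "?\<alpha> * \<bar>?r\<bar> = \<bar>?\<alpha> * ?r\<bar>"
      by (auto simp: abs_mult)
    ultimately have "2 * s - p \<le> A"
      unfolding p_def distrib_left by linarith
    \<comment> \<open>This product is the difference of the two sides of the next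
      inequality.\<close>
    have "0 \<le> (s - p) * (p + 2 * s + q)" using 2 sq \<open>0 < s\<close> by (auto simp: p_def)
    then have "p\<^sup>2 + s * q \<le> (s + q) * (2 * s - p)" by (simp add: algebra_simps power2_eq_square)
    also have "\<dots> \<le> (s + q) * A" using \<open>2 * s - p \<le> A\<close> sq \<open>0 < s\<close> by (intro mult_left_mono) auto
    finally show ?thesis using X res by (simp add: A_def)
  next
    case 3
    have "avg (?C e) (\<lambda>t. (\<phi> t)\<^sup>2) \<le> (s + q) * avg (?C e) (\<lambda>t. \<bar>\<phi> t\<bar>) + residual d (m - 1) (dyadic_child k e) \<phi>" for e
    proof (rule Suc.IH)
      show "\<forall>J\<in>dyadic_subcubes (?C e). variance J \<phi> \<le> s * q"
        using Suc.prems(3) dyadic_subcubes_child[of _ m k e] by blast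
    qed (use Suc.prems 3 set_integrable_child in blast)+
    then have "?\<alpha> * (\<Sum>e\<in>UNIV. avg (?C e) (\<lambda>t. (\<phi> t)\<^sup>2)) \<le> ?\<alpha> * (\<Sum>e\<in>UNIV. (s + q) * avg (?C e) (\<lambda>t. \<bar>\<phi> t\<bar>)
       + residual d (m - 1) (dyadic_child k e) \<phi>)"
      by (intro mult_left_mono sum_mono) auto
    then show ?thesis
      unfolding avg_children[OF set_integrable_abs[OF Suc.prems(1)]] avg_children[OF Suc.prems(2)]
        sum.distrib sum_distrib_left[symmetric] residual.simps distrib_left
      by (simp only: mult_ac)
  qed
qed

lemma avg_square_le:
  fixes \<phi> :: "real ^ 'n \<Rightarrow> real" and s q :: real
  assumes "set_integrable lebesgue (dyadic_cube m k) \<phi>"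
    "set_integrable lebesgue (dyadic_cube m k) (\<lambda>t. (\<phi> t)\<^sup>2)"
    and "\<forall>J\<in>dyadic_subcubes (dyadic_cube m k). variance J \<phi> \<le> s * q"
    and "0 < q" "s = (1/2) ^ CARD('n) * q"
    and "\<bar>avg (dyadic_cube m k) \<phi>\<bar> \<le> q"
  shows "avg (dyadic_cube m k) (\<lambda>t. (\<phi> t)\<^sup>2) \<le> (s + q) * avg (dyadic_cube m k) (\<lambda>t. \<bar>\<phi> t\<bar>)"
proof (rule field_le_epsilon)
  fix e :: real assume "0 < e"
  then obtain d where "residual d m k \<phi> < e"
    using residual_small[OF assms(1,2)] by blast
  then show "avg (dyadic_cube m k) (\<lambda>t. (\<phi> t)\<^sup>2) \<le> (s + q) * avg (dyadic_cube m k) (\<lambda>t. \<bar>\<phi> t\<bar>) + e"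
    using avg_square_le_residual[OF assms, of d] by simp
qed

lemma bellman_ge_b_alpha:
  fixes Q :: "(real ^ 'n) set"
  assumes Q: "Q \<in> dyadic_cubes" and \<epsilon>: "0 < \<epsilon>"
  shows "ereal (b_alpha ((1/2) ^ CARD('n)) \<epsilon> x) \<le> bellman Q \<epsilon> x"
  unfolding bellman_def
proof (rule INF_greatest)
  fix \<phi> assume \<phi>: "\<phi> \<in> {\<phi> \<in> BMO_dyadic \<epsilon> Q. avg Q \<phi> = fst x \<and> avg Q (\<lambda>t. (\<phi> t)\<^sup>2) = snd x}"
  obtain m k where mk: "Q = dyadic_cube m k" using Q by (auto simp: dyadic_cubes_def)
  have int: "set_integrable lebesgue Q \<phi>" "set_integrable lebesgue Q (\<lambda>t. (\<phi> t)\<^sup>2)"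
    and var: "\<forall>J\<in>dyadic_subcubes Q. variance J \<phi> \<le> \<epsilon>\<^sup>2"
    and x: "avg Q \<phi> = fst x" "avg Q (\<lambda>t. (\<phi> t)\<^sup>2) = snd x"
    using \<phi> \<epsilon> by (auto simp: mk mem_BMO_dyadic_iff)
  define \<alpha> :: real where "\<alpha> = (1/2) ^ CARD('n)"
  define r where "r = sqrt \<alpha>"
  have \<alpha>: "0 < \<alpha>" "\<alpha> \<le> 1" by (auto simp: \<alpha>_def power_le_one)
  have r: "0 < r" "r \<le> 1" "\<alpha> = r * r" using \<alpha> by (auto simp: r_def)
  have "b_alpha \<alpha> \<epsilon> x \<le> avg Q (\<lambda>t. \<bar>\<phi> t\<bar>)"
  proof (cases "x \<in> Omega0 \<alpha> \<epsilon>")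
    case True
    then have "\<bar>fst x\<bar> \<le> r * \<epsilon>" by (auto simp: Omega0_def r_def)
    also have "\<dots> \<le> \<epsilon> / r"
      using r \<epsilon> mult_le_one[of r r] by (simp add: field_simps)
    finally have mean: "\<bar>avg Q \<phi>\<bar> \<le> \<epsilon> / r" by (simp only: x)
    \<comment> \<open>The numbers \<open>r * \<epsilon>\<close> and \<open>\<epsilon> / r\<close>
      are the \<open>s\<close> and \<open>q\<close> of \<open>avg_square_le\<close>.\<close>
    have sq: "r * \<epsilon> * (\<epsilon> / r) = \<epsilon>\<^sup>2" "r * \<epsilon> = \<alpha> * (\<epsilon> / r)"
      using r by (auto simp: power2_eq_square)
    define A where "A = avg Q (\<lambda>t. \<bar>\<phi> t\<bar>)"
    have "snd x \<le> (r * \<epsilon> + \<epsilon> / r) * A"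
      unfolding x(2)[symmetric] A_def mk
    proof (rule avg_square_le)
      show "r * \<epsilon> = (1/2) ^ CARD('n) * (\<epsilon> / r)" using sq(2) unfolding \<alpha>_def .
      show "\<forall>J\<in>dyadic_subcubes (dyadic_cube m k). variance J \<phi> \<le> r * \<epsilon> * (\<epsilon> / r)"
        using var unfolding mk sq(1) .
    qed (use int mean r(1) \<epsilon> in \<open>simp_all add: mk\<close>)
    then have "r / ((1 + \<alpha>) * \<epsilon>) * snd x \<le> r / ((1 + \<alpha>) * \<epsilon>) * ((r * \<epsilon> + \<epsilon> / r) * A)"
      using r(1) \<alpha>(1) \<epsilon> by (intro mult_left_mono) auto
    also have "r * \<epsilon> + \<epsilon> / r = (1 + \<alpha>) * \<epsilon> / r"
      unfolding r(3) using r(1) by (simp add: field_simps)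
    also have "r / ((1 + \<alpha>) * \<epsilon>) * ((1 + \<alpha>) * \<epsilon> / r * A) = A"
      using r(1) \<alpha>(1) \<epsilon> by simp
    finally show ?thesis
      using True by (simp add: b_alpha_def r_def[symmetric] A_def)
  next
    case False
    then show ?thesis using abs_avg_le[OF int(1)] by (simp add: b_alpha_def x)
  qed
  then show "ereal (b_alpha ((1/2) ^ CARD('n)) \<epsilon> x) \<le> ereal (avg Q (\<lambda>t. \<bar>\<phi> t\<bar>))"
    by (simp add: \<alpha>_def)
qed

subsection \<open>The upper bound\<close>

text \<open>The bound is required on all cubes at once, so that extremal functions for the children of a
  cube are available without translating or rescaling.\<close>

definition bellman_le :: "'n::finite itself \<Rightarrow> real \<Rightarrow> real \<times> real \<Rightarrow> real \<Rightarrow> bool" where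
  "bellman_le _ \<epsilon> x y \<longleftrightarrow> (\<forall>Q\<in>(dyadic_cubes :: (real ^ 'n) set set). bellman Q \<epsilon> x \<le> ereal y)"

lemma bellman_le_mono: "bellman_le T \<epsilon> x y \<Longrightarrow> y \<le> y' \<Longrightarrow> bellman_le T \<epsilon> x y'"
  unfolding bellman_le_def by (intro ballI, rule order_trans[of _ "ereal y"]) auto

text \<open>The infimum need not be known to be attained: constructions may use functions that miss
  the bound by an arbitrary \<open>\<delta>\<close>.\<close>

lemma bellman_le_epsilon:
  assumes "\<And>\<delta>. 0 < \<delta> \<Longrightarrow> bellman_le T \<epsilon> x (y + \<delta>)"
  shows "bellman_le T \<epsilon> x y"
  unfolding bellman_le_def
proof (rule ballI, rule ereal_le_epsilon2)
  fix Q :: "(real ^ 'a) set" and \<delta> :: real assume Q: "Q \<in> dyadic_cubes" and \<delta>: "0 < \<delta>"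
  show "bellman Q \<epsilon> x \<le> ereal y + ereal \<delta>"
    using bspec[OF assms[OF \<delta>, unfolded bellman_le_def] Q] by simp
qed

lemma bellman_leI:
  assumes "\<phi> \<in> BMO_dyadic \<epsilon> Q" "avg Q \<phi> = fst x" "avg Q (\<lambda>t. (\<phi> t)\<^sup>2) = snd x"
    and "avg Q (\<lambda>t. \<bar>\<phi> t\<bar>) \<le> y"
  shows "bellman Q \<epsilon> x \<le> ereal y"
  unfolding bellman_def by (rule INF_lower2[of \<phi>]) (simp_all add: assms)

lemma bellman_le_const:
  assumes "0 \<le> \<epsilon>"
  shows "bellman_le T \<epsilon> (a, a\<^sup>2) \<bar>a\<bar>"
  unfolding bellman_le_def
proof
  fix Q :: "(real ^ 'a) set" assume "Q \<in> dyadic_cubes"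
  then obtain m k where mk: "Q = dyadic_cube m k" by (auto simp: dyadic_cubes_def)
  have "variance J (\<lambda>t. a) = 0" if "J \<in> dyadic_subcubes Q" for J
    using that by (auto simp: variance_def avg_const dyadic_subcubes_def dyadic_cubes_def)
  then show "bellman Q \<epsilon> (a, a\<^sup>2) \<le> ereal \<bar>a\<bar>"
    using assms
    by (intro bellman_leI[of "\<lambda>t. a"]) (auto simp: mk mem_BMO_dyadic_iff set_integrable_const avg_const)
qed

lemma bellman_le_uminus:
  assumes "0 \<le> \<epsilon>" "bellman_le T \<epsilon> (x1, x2) y"
  shows "bellman_le T \<epsilon> (- x1, x2) y"
proof (rule bellman_le_epsilon, unfold bellman_le_def, rule ballI)
  fix \<delta> :: real and Q :: "(real ^ 'a) set" assume "0 < \<delta>" "Q \<in> dyadic_cubes"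
  then obtain m k where mk: "Q = dyadic_cube m k" by (auto simp: dyadic_cubes_def)
  have "bellman Q \<epsilon> (x1, x2) \<le> ereal y"
    using assms(2) \<open>Q \<in> dyadic_cubes\<close> unfolding bellman_le_def by blast
  also have "\<dots> < ereal (y + \<delta>)" using \<open>0 < \<delta>\<close> by simp
  finally have "bellman Q \<epsilon> (x1, x2) < ereal (y + \<delta>)" .
  then obtain \<phi> where \<phi>: "\<phi> \<in> BMO_dyadic \<epsilon> Q" "avg Q \<phi> = x1" "avg Q (\<lambda>t. (\<phi> t)\<^sup>2) = x2"
    "avg Q (\<lambda>t. \<bar>\<phi> t\<bar>) < y + \<delta>"
    unfolding bellman_def INF_less_iff by auto
  have neg: "avg J (\<lambda>t. - \<phi> t) = - avg J \<phi>" for J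
    using avg_mult[of J "-1" \<phi>] by simp
  have "set_integrable lebesgue Q (\<lambda>t. - \<phi> t)"
    using \<phi>(1) assms(1) set_integrable_mult_right[of "-1" lebesgue Q \<phi>] by (simp add: mk mem_BMO_dyadic_iff)
  then show "bellman Q \<epsilon> (- x1, x2) \<le> ereal (y + \<delta>)"
    using \<phi> assms(1)
    by (intro bellman_leI[of "\<lambda>t. - \<phi> t"]) (auto simp: mk mem_BMO_dyadic_iff neg variance_def)
qed

section \<open>Gluing and interpolation along segments\<close>

lemma bellman_le_concat:
  fixes T :: "'n::finite itself" and X :: "'n set \<Rightarrow> real \<times> real"
  assumes \<epsilon>: "0 \<le> \<epsilon>" and X: "\<And>e. bellman_le T \<epsilon> (X e) (Y e)"
    and x1: "x1 = (1/2) ^ CARD('n) * (\<Sum>e\<in>UNIV. fst (X e))"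
    and x2: "x2 = (1/2) ^ CARD('n) * (\<Sum>e\<in>UNIV. snd (X e))"
    and v: "x2 - x1\<^sup>2 \<le> \<epsilon>\<^sup>2"
  shows "bellman_le T \<epsilon> (x1, x2) ((1/2) ^ CARD('n) * (\<Sum>e\<in>UNIV. Y e))"
proof (rule bellman_le_epsilon, unfold bellman_le_def, rule ballI)
  fix \<delta> :: real and Q :: "(real ^ 'n) set" assume \<delta>: "0 < \<delta>" and "Q \<in> dyadic_cubes"
  then obtain m k where mk: "Q = dyadic_cube m k" by (auto simp: dyadic_cubes_def)
  let ?C = "\<lambda>e. dyadic_cube (m - 1) (dyadic_child k e)"
  have "\<exists>\<phi>. \<phi> \<in> BMO_dyadic \<epsilon> (?C e) \<and> avg (?C e) \<phi> = fst (X e) \<and>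
      avg (?C e) (\<lambda>t. (\<phi> t)\<^sup>2) = snd (X e) \<and> avg (?C e) (\<lambda>t. \<bar>\<phi> t\<bar>) < Y e + \<delta>" for e
  proof -
    have "bellman (?C e) \<epsilon> (X e) \<le> ereal (Y e)"
      using X[of e] unfolding bellman_le_def by (rule bspec) simp
    also have "\<dots> < ereal (Y e + \<delta>)" using \<delta> by simp
    finally show ?thesis unfolding bellman_def INF_less_iff by auto
  qed
  then obtain \<phi> where \<phi>: "\<And>e. \<phi> e \<in> BMO_dyadic \<epsilon> (?C e)" "\<And>e. avg (?C e) (\<phi> e) = fst (X e)"
    "\<And>e. avg (?C e) (\<lambda>t. (\<phi> e t)\<^sup>2) = snd (X e)" "\<And>e. avg (?C e) (\<lambda>t. \<bar>\<phi> e t\<bar>) < Y e + \<delta>"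
    by metis
  \<comment> \<open>By disjointness the choice returns the only child containing \<open>t\<close>,
    for \<open>t\<close> in the cube.\<close>
  define \<Phi> where "\<Phi> t = \<phi> (SOME e. t \<in> ?C e) t" for t
  have \<Phi>: "\<Phi> t = \<phi> e t" if "t \<in> ?C e" for e t
  proof -
    have "(SOME e. t \<in> ?C e) = e"
      using that disjoint_family_children[of m k] unfolding disjoint_family_on_def
      by (intro some_equality) auto
    then show ?thesis by (simp add: \<Phi>_def)
  qed
  have int_e: "set_integrable lebesgue (?C e) (\<phi> e)" "set_integrable lebesgue (?C e) (\<lambda>t. (\<phi> e t)\<^sup>2)"
    and var_e: "\<And>J. J \<in> dyadic_subcubes (?C e) \<Longrightarrow> variance J (\<phi> e) \<le> \<epsilon>\<^sup>2" for e
    using \<phi>(1)[of e] \<epsilon> by (auto simp: mem_BMO_dyadic_iff)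
  have "set_integrable lebesgue (?C e) \<Phi>" "set_integrable lebesgue (?C e) (\<lambda>t. (\<Phi> t)\<^sup>2)" for e
    using int_e[of e] \<Phi>[of _ e] by (simp_all cong: set_integrable_cong)
  then have int: "set_integrable lebesgue Q \<Phi>" "set_integrable lebesgue Q (\<lambda>t. (\<Phi> t)\<^sup>2)"
    unfolding mk by (blast intro: set_integrable_from_children)+
  have av: "avg Q (\<lambda>t. f (\<Phi> t)) = (1/2) ^ CARD('n) * (\<Sum>e\<in>UNIV. avg (?C e) (\<lambda>t. f (\<phi> e t)))"
    if "set_integrable lebesgue Q (\<lambda>t. f (\<Phi> t))" for f
    unfolding mk avg_children[OF that[unfolded mk]]
    by (intro arg_cong2[of _ _ _ _ "(*)"] sum.cong refl avg_cong) (auto simp: \<Phi>)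
  have a1: "avg Q \<Phi> = x1" using av[of "\<lambda>z. z"] int x1 \<phi>(2) by simp
  have a2: "avg Q (\<lambda>t. (\<Phi> t)\<^sup>2) = x2" using av[of "\<lambda>z. z\<^sup>2"] int x2 \<phi>(3) by simp
  have "avg Q (\<lambda>t. \<bar>\<Phi> t\<bar>) \<le> (1/2) ^ CARD('n) * (\<Sum>e\<in>(UNIV::'n set set). Y e + \<delta>)"
    unfolding av[OF set_integrable_abs[OF int(1)]]
    using \<phi>(4) by (intro mult_left_mono sum_mono) (auto intro: less_imp_le)
  also have "\<dots> = (1/2) ^ CARD('n) * (\<Sum>e\<in>UNIV. Y e) + \<delta>"
    using sum_children_const[of \<delta>, where 'n = 'n] unfolding sum.distrib distrib_left by simp
  finally have a3: "avg Q (\<lambda>t. \<bar>\<Phi> t\<bar>) \<le> (1/2) ^ CARD('n) * (\<Sum>e\<in>UNIV. Y e) + \<delta>" .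
  \<comment> \<open>A proper dyadic subcube lies in one child, where \<open>\<Phi>\<close> is
    admissible already; only the top cube needs the hypothesis \<open>v\<close>.\<close>
  have "variance J \<Phi> \<le> \<epsilon>\<^sup>2" if J: "J \<in> dyadic_subcubes (dyadic_cube m k)" for J
    using J
  proof (cases rule: dyadic_subcubes_cases)
    case 1
    then show ?thesis using a1 a2 v by (simp add: variance_def mk)
  next
    case (2 e)
    then have "J \<subseteq> ?C e" "J \<in> sets lebesgue" by (auto simp: dyadic_subcubes_def dyadic_cubes_def)
    then have "avg J \<Phi> = avg J (\<phi> e)" "avg J (\<lambda>t. (\<Phi> t)\<^sup>2) = avg J (\<lambda>t. (\<phi> e t)\<^sup>2)"
      using \<Phi>[of _ e] by (auto intro!: avg_cong)
    then show ?thesis using var_e[OF 2] by (simp add: variance_def)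
  qed
  then have "\<Phi> \<in> BMO_dyadic \<epsilon> Q"
    using int \<epsilon> by (simp add: mk mem_BMO_dyadic_iff)
  then show "bellman Q \<epsilon> (x1, x2) \<le> ereal ((1/2) ^ CARD('n) * (\<Sum>e\<in>UNIV. Y e) + \<delta>)"
    using a1 a2 a3 by (intro bellman_leI[of \<Phi>]) auto
qed

text \<open>One child carries \<open>Z\<close>, \<open>j\<close> children carry \<open>B\<close> and
  the others carry \<open>A\<close>. This is one digit of the expansion used in
  \<open>bellman_le_segment\<close>.\<close>

lemma bellman_le_combine3:
  fixes A B Z :: "real \<times> real" and T :: "'n::finite itself" and \<alpha> :: real and j :: nat
  assumes \<epsilon>: "0 \<le> \<epsilon>" and A: "bellman_le T \<epsilon> A yA" and B: "bellman_le T \<epsilon> B yB"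
    and Z: "bellman_le T \<epsilon> Z yZ" and j: "j < 2 ^ CARD('n)" and \<alpha>: "\<alpha> = (1/2) ^ CARD('n)"
    and x1: "x1 = \<alpha> * j * fst B + \<alpha> * fst Z + (1 - \<alpha> - \<alpha> * j) * fst A"
    and x2: "x2 = \<alpha> * j * snd B + \<alpha> * snd Z + (1 - \<alpha> - \<alpha> * j) * snd A"
    and v: "x2 - x1\<^sup>2 \<le> \<epsilon>\<^sup>2"
  shows "bellman_le T \<epsilon> (x1, x2) (\<alpha> * j * yB + \<alpha> * yZ + (1 - \<alpha> - \<alpha> * j) * yA)"
proof -
  have c: "card (UNIV::'n set set) = 2 ^ CARD('n)"
    using card_Pow[of "UNIV::'n set"] by simp
  obtain S :: "'n set set" where S: "card S = j"
    using obtain_subset_with_card_n[of j "UNIV::'n set set"] j c by auto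
  have "S \<noteq> UNIV" using S j c by auto
  then obtain e0 where e0: "e0 \<notin> S" by blast
  have \<alpha>2: "\<alpha> * 2 ^ CARD('n) = 1" by (simp add: \<alpha> power_one_over)
  have sum: "\<alpha> * (\<Sum>e\<in>UNIV. if e = e0 then z else if e \<in> S then b else a)
    = \<alpha> * j * b + \<alpha> * z + (1 - \<alpha> - \<alpha> * j) * a" for a b z :: real
  proof -
    \<comment> \<open>Writing the nested conditional as \<open>a\<close> plus two separate
      corrections is possible because \<open>e0\<close> lies outside \<open>S\<close>.\<close>
    have "(\<Sum>e\<in>UNIV. if e = e0 then z else if e \<in> S then b else a)
        = (\<Sum>e\<in>UNIV. a + (if e = e0 then z - a else 0) + (if e \<in> S then b - a else 0))"
      using e0 by (intro sum.cong) auto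
    also have "\<dots> = 2 ^ CARD('n) * a + (z - a) + j * (b - a)"
      using S c by (simp add: sum.distrib sum.If_cases)
    finally have eq: "(\<Sum>e\<in>UNIV. if e = e0 then z else if e \<in> S then b else a)
      = 2 ^ CARD('n) * a + (z - a) + j * (b - a)" .
    have "\<alpha> * (2 ^ CARD('n) * a + (z - a) + j * (b - a))
      = (\<alpha> * 2 ^ CARD('n)) * a + \<alpha> * (z - a) + \<alpha> * j * (b - a)"
      by (simp add: algebra_simps)
    then show ?thesis unfolding eq \<alpha>2 by (simp add: algebra_simps)
  qed
  let ?X = "\<lambda>e. if e = e0 then Z else if e \<in> S then B else A"
  let ?Y = "\<lambda>e. if e = e0 then yZ else if e \<in> S then yB else yA"
  have "bellman_le T \<epsilon> (x1, x2) ((1/2) ^ CARD('n) * (\<Sum>e\<in>UNIV. ?Y e))"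
  proof (rule bellman_le_concat[OF \<epsilon> _ _ _ v])
    show "bellman_le T \<epsilon> (?X e) (?Y e)" for e
      using A B Z by auto
    have *: "fst (?X e) = (if e = e0 then fst Z else if e \<in> S then fst B else fst A)"
      "snd (?X e) = (if e = e0 then snd Z else if e \<in> S then snd B else snd A)" for e
      by auto
    show "x1 = (1/2) ^ CARD('n) * (\<Sum>e\<in>UNIV. fst (?X e))"
      unfolding * \<alpha>[symmetric] sum by (rule x1)
    show "x2 = (1/2) ^ CARD('n) * (\<Sum>e\<in>UNIV. snd (?X e))"
      unfolding * \<alpha>[symmetric] sum by (rule x2)
  qed
  then show ?thesis unfolding \<alpha>[symmetric] sum .
qed

lemma bellman_le_combine2:
  fixes A Z :: "real \<times> real" and T :: "'n::finite itself"
  assumes "0 \<le> \<epsilon>" and "bellman_le T \<epsilon> A yA" "bellman_le T \<epsilon> Z yZ" "\<alpha> = (1/2) ^ CARD('n)"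
    and "x1 = \<alpha> * fst Z + (1 - \<alpha>) * fst A" "x2 = \<alpha> * snd Z + (1 - \<alpha>) * snd A"
    and "x2 - x1\<^sup>2 \<le> \<epsilon>\<^sup>2"
  shows "bellman_le T \<epsilon> (x1, x2) (\<alpha> * yZ + (1 - \<alpha>) * yA)"
  using bellman_le_combine3[where B = A and yB = yA and j = 0, of \<epsilon> T A yA Z yZ \<alpha> x1 x2] assms by simp

text \<open>The function takes the value \<open>x1 + (1 - \<alpha>) * d\<close> on one child and
  \<open>x1 - \<alpha> * d\<close> on the others: its mean is \<open>x1\<close> and its variance
  \<open>\<alpha> * (1 - \<alpha>) * d\<^sup>2\<close>.\<close>

lemma bellman_le_two_values:
  fixes T :: "'n::finite itself"
  assumes "0 \<le> \<epsilon>" "\<alpha> = (1/2) ^ CARD('n)" "x2 = x1\<^sup>2 + \<alpha> * (1 - \<alpha>) * d\<^sup>2" "x2 - x1\<^sup>2 \<le> \<epsilon>\<^sup>2"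
  shows "bellman_le T \<epsilon> (x1, x2) (\<alpha> * \<bar>x1 + (1 - \<alpha>) * d\<bar> + (1 - \<alpha>) * \<bar>x1 - \<alpha> * d\<bar>)"
  using assms(2-4)
  by (intro bellman_le_combine2[OF assms(1) bellman_le_const[OF assms(1)] bellman_le_const[OF assms(1)]])
     (auto simp: algebra_simps power2_eq_square)

lemma two_value_gap:
  fixes \<alpha> v :: real
  assumes "0 < \<alpha>" "\<alpha> < 1" "0 \<le> v"
  obtains d where "0 \<le> d" "v = \<alpha> * (1 - \<alpha>) * d\<^sup>2"
  using that[of "sqrt (v / (\<alpha> * (1 - \<alpha>)))"] assms by simp

lemma half_power_card: "0 < (1/2::real) ^ CARD('n::finite)" "(1/2::real) ^ CARD('n) \<le> 1/2"
  using power_decreasing[of 1 "CARD('n)" "1/2::real"] by (auto simp: Suc_leI)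

text \<open>The size of this bound is irrelevant: it only starts the iteration in the next lemma, where
  it is damped by the factor \<open>2\<^sup>-\<^sup>n\<close> at each step.\<close>

lemma bellman_le_crude:
  fixes T :: "'n::finite itself"
  assumes "0 \<le> \<epsilon>" "x1\<^sup>2 \<le> x2" "x2 - x1\<^sup>2 \<le> \<epsilon>\<^sup>2"
  shows "bellman_le T \<epsilon> (x1, x2) (1 + x2)"
proof -
  define \<alpha> :: real where "\<alpha> = (1/2) ^ CARD('n)"
  have \<alpha>: "0 < \<alpha>" "\<alpha> \<le> 1/2" using half_power_card[where 'n = 'n] by (auto simp: \<alpha>_def)
  obtain d where d: "0 \<le> d" "x2 - x1\<^sup>2 = \<alpha> * (1 - \<alpha>) * d\<^sup>2"
    using two_value_gap[of \<alpha> "x2 - x1\<^sup>2"] \<alpha> assms(2) by auto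
  have le: "\<bar>z\<bar> \<le> 1 + z\<^sup>2" for z :: real
    using zero_le_power2[of "\<bar>z\<bar> - 1"] by (simp add: power2_diff)
  have "\<alpha> * \<bar>x1 + (1 - \<alpha>) * d\<bar> + (1 - \<alpha>) * \<bar>x1 - \<alpha> * d\<bar>
      \<le> \<alpha> * (1 + (x1 + (1 - \<alpha>) * d)\<^sup>2) + (1 - \<alpha>) * (1 + (x1 - \<alpha> * d)\<^sup>2)"
    using \<alpha> le by (intro add_mono mult_left_mono) auto
  also have "\<dots> = 1 + (x1\<^sup>2 + \<alpha> * (1 - \<alpha>) * d\<^sup>2)" by (simp add: algebra_simps power2_eq_square)
  also have "\<dots> = 1 + x2" using d by simp
  finally show ?thesis
    using d assms by (intro bellman_le_mono[OF bellman_le_two_values[of \<epsilon> \<alpha> x2 x1 d]]) (auto simp: \<alpha>_def)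
qed

text \<open>Expand \<open>\<theta>\<close> in base \<open>2 ^ CARD('n)\<close>. The first digit
  counts the children placed at the endpoint \<open>B\<close>; one child takes the point of the same
  segment whose parameter is the remainder, the others take \<open>A\<close>. The error thus shrinks
  by the factor \<open>\<alpha>\<close> at each step.\<close>

lemma bellman_le_segment:
  fixes T :: "'n::finite itself"
  assumes \<epsilon>: "0 \<le> \<epsilon>" and A: "bellman_le T \<epsilon> (a1, a2) yA" and B: "bellman_le T \<epsilon> (b1, b2) yB"
    and nn: "0 \<le> yA" "0 \<le> yB"
    and seg: "\<And>\<theta>. 0 \<le> \<theta> \<Longrightarrow> \<theta> \<le> 1 \<Longrightarrow> ((1 - \<theta>) * a1 + \<theta> * b1)\<^sup>2 \<le> (1 - \<theta>) * a2 + \<theta> * b2"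
      "\<And>\<theta>. 0 \<le> \<theta> \<Longrightarrow> \<theta> \<le> 1 \<Longrightarrow> (1 - \<theta>) * a2 + \<theta> * b2 - ((1 - \<theta>) * a1 + \<theta> * b1)\<^sup>2 \<le> \<epsilon>\<^sup>2"
    and \<theta>: "0 \<le> \<theta>" "\<theta> \<le> 1"
  shows "bellman_le T \<epsilon> ((1 - \<theta>) * a1 + \<theta> * b1, (1 - \<theta>) * a2 + \<theta> * b2) ((1 - \<theta>) * yA + \<theta> * yB)"
proof -
  define \<alpha> :: real where "\<alpha> = (1/2) ^ CARD('n)"
  have \<alpha>: "0 < \<alpha>" "\<alpha> \<le> 1/2" using half_power_card[where 'n = 'n] by (auto simp: \<alpha>_def)
  have \<alpha>2: "\<alpha> * 2 ^ CARD('n) = 1" by (simp add: \<alpha>_def power_one_over)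
  have "a2 \<ge> 0" "b2 \<ge> 0"
    using order_trans[OF zero_le_power2 seg(1)[of 0]] order_trans[OF zero_le_power2 seg(1)[of 1]] by auto
  \<comment> \<open>The initial error: it dominates the bound of \<open>bellman_le_crude\<close> at
    every point of the segment.\<close>
  define M where "M = 1 + a2 + b2"
  have approx: "bellman_le T \<epsilon> ((1 - \<theta>) * a1 + \<theta> * b1, (1 - \<theta>) * a2 + \<theta> * b2)
      ((1 - \<theta>) * yA + \<theta> * yB + \<alpha> ^ i * M)" if "0 \<le> \<theta>" "\<theta> \<le> 1" for i \<theta>
    using that
  proof (induction i arbitrary: \<theta>)
    case 0
    have "0 \<le> (1 - \<theta>) * yA + \<theta> * yB" using 0 nn by simp
    moreover have "(1 - \<theta>) * a2 \<le> a2" "\<theta> * b2 \<le> b2"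
      using 0 \<open>a2 \<ge> 0\<close> \<open>b2 \<ge> 0\<close> by (auto simp: mult_left_le_one_le)
    ultimately show ?case
      using seg[OF 0] \<epsilon> by (intro bellman_le_mono[OF bellman_le_crude]) (auto simp: M_def)
  next
    case (Suc i)
    show ?case
    \<comment> \<open>At \<open>\<theta> = 1\<close> the digit would be \<open>2 ^ CARD('n)\<close>,
      which exceeds the largest admissible digit.\<close>
    proof (cases "\<theta> = 1")
      case True
      then have "bellman_le T \<epsilon> ((1 - \<theta>) * a1 + \<theta> * b1, (1 - \<theta>) * a2 + \<theta> * b2) yB"
        using B by simp
      then show ?thesis
        by (rule bellman_le_mono) (use True \<alpha> \<open>a2 \<ge> 0\<close> \<open>b2 \<ge> 0\<close> in \<open>simp add: M_def\<close>)
    next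
      case False
      define z j where "z = 2 ^ CARD('n) * \<theta>" and "j = nat \<lfloor>z\<rfloor>"
      have z: "0 \<le> z" "z < 2 ^ CARD('n)" "\<alpha> * z = \<theta>"
        using Suc.prems False \<alpha>2 by (auto simp: z_def)
      have j: "real j \<le> z" "z < real j + 1" using z(1) by (auto simp: j_def)
      have "real j < 2 ^ CARD('n)" by (rule le_less_trans[OF j(1) z(2)])
      then have j2: "j < 2 ^ CARD('n)" by simp
      define \<theta>' where "\<theta>' = z - j"
      have "0 \<le> \<theta>'" "\<theta>' \<le> 1" using j by (auto simp: \<theta>'_def)
      note IH = Suc.IH[OF this]
      have split: "(1 - \<theta>) * a + \<theta> * b = \<alpha> * j * b + \<alpha> * ((1 - \<theta>') * a + \<theta>' * b) + (1 - \<alpha> - \<alpha> * j) * a" for a b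
        unfolding z(3)[symmetric] \<theta>'_def by (simp add: algebra_simps)
      have "bellman_le T \<epsilon> ((1 - \<theta>) * a1 + \<theta> * b1, (1 - \<theta>) * a2 + \<theta> * b2)
         (\<alpha> * j * yB + \<alpha> * ((1 - \<theta>') * yA + \<theta>' * yB + \<alpha> ^ i * M) + (1 - \<alpha> - \<alpha> * j) * yA)"
        by (rule bellman_le_combine3[OF \<epsilon> A B IH j2 \<alpha>_def _ _ seg(2)[OF Suc.prems]]) (auto simp: split)
      then show ?thesis unfolding split[of yA yB] by (simp add: algebra_simps)
    qed
  qed
  show ?thesis
  proof (rule bellman_le_epsilon)
    fix \<delta> :: real assume "0 < \<delta>"
    have "(\<lambda>i. \<alpha> ^ i * M) \<longlonglongrightarrow> 0 * M"
      using \<alpha> by (intro tendsto_intros LIMSEQ_power_zero) auto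
    then obtain i where "\<alpha> ^ i * M < \<delta>"
      using order_tendstoD(2)[of "\<lambda>i. \<alpha> ^ i * M" 0 sequentially \<delta>] \<open>0 < \<delta>\<close>
      by (auto simp: eventually_sequentially)
    then show "bellman_le T \<epsilon> ((1 - \<theta>) * a1 + \<theta> * b1, (1 - \<theta>) * a2 + \<theta> * b2) ((1 - \<theta>) * yA + \<theta> * yB + \<delta>)"
      by (intro bellman_le_mono[OF approx[OF \<theta>, of i]]) simp
  qed
qed

text \<open>The assumptions determine \<open>s\<close> and \<open>q\<close> as \<epsilon> times and
  divided by the square root of \<alpha>; stating them as relations keeps square roots out of the
  estimates.\<close>

locale bellman_parameters =
  fixes T :: "'n::finite itself" and \<epsilon> \<alpha> s q :: real
  assumes \<epsilon>: "0 < \<epsilon>" and \<alpha>_def: "\<alpha> = (1/2) ^ CARD('n)"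
    and s_pos: "0 < s" and s_eq: "s = \<alpha> * q" and s_mult_q: "s * q = \<epsilon>\<^sup>2"
begin

section \<open>Upper bounds on the regions of the domain\<close>

lemma \<alpha>: "0 < \<alpha>" "\<alpha> \<le> 1/2"
  using half_power_card[where 'n = 'n] by (auto simp: \<alpha>_def)

lemma q_ge: "2 * s \<le> q"
proof -
  have "0 < q" using s_pos \<alpha>(1) unfolding s_eq by (simp add: zero_less_mult_iff)
  then show ?thesis using \<alpha>(2) unfolding s_eq by simp
qed

lemma s_square: "s\<^sup>2 = \<alpha> * \<epsilon>\<^sup>2"
proof -
  have "s * s = \<alpha> * (s * q)" by (simp only: s_eq mult_ac)
  then show ?thesis unfolding s_mult_q power2_eq_square[of s] .
qed

lemma s_square_le: "s\<^sup>2 \<le> \<epsilon>\<^sup>2"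
  using \<alpha> by (simp add: s_square mult_left_le_one_le)

text \<open>The last hypothesis says that the smaller value \<open>x1 - \<alpha> * d\<close> is
  nonnegative, so the mean of the modulus is the mean itself.\<close>

lemma bellman_le_two_values_nonneg:
  assumes "0 \<le> x1" "x1\<^sup>2 \<le> x2" "x2 - x1\<^sup>2 \<le> \<epsilon>\<^sup>2" "\<alpha> * (x2 - x1\<^sup>2) \<le> x1\<^sup>2 * (1 - \<alpha>)"
  shows "bellman_le T \<epsilon> (x1, x2) x1"
proof -
  obtain d where d: "0 \<le> d" "x2 - x1\<^sup>2 = \<alpha> * (1 - \<alpha>) * d\<^sup>2"
    using two_value_gap[of \<alpha> "x2 - x1\<^sup>2"] \<alpha> assms(2) by auto
  have "(1 - \<alpha>) * (\<alpha> * d)\<^sup>2 = \<alpha> * (x2 - x1\<^sup>2)"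
    unfolding d(2) by (simp add: power2_eq_square)
  also have "\<dots> \<le> (1 - \<alpha>) * x1\<^sup>2" using assms(4) by (simp add: mult.commute)
  finally have "(\<alpha> * d)\<^sup>2 \<le> x1\<^sup>2" using \<alpha> by simp
  then have "\<alpha> * d \<le> x1" using assms(1) by (rule power2_le_imp_le)
  moreover have "0 \<le> x1 + (1 - \<alpha>) * d" using assms(1) d(1) \<alpha> by simp
  ultimately have eq: "\<alpha> * \<bar>x1 + (1 - \<alpha>) * d\<bar> + (1 - \<alpha>) * \<bar>x1 - \<alpha> * d\<bar> = x1"
    by (simp add: algebra_simps)
  have "bellman_le T \<epsilon> (x1, x2) (\<alpha> * \<bar>x1 + (1 - \<alpha>) * d\<bar> + (1 - \<alpha>) * \<bar>x1 - \<alpha> * d\<bar>)"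
    using d \<epsilon> assms by (intro bellman_le_two_values[OF _ \<alpha>_def]) auto
  then show ?thesis unfolding eq .
qed

text \<open>If the two-valued function would become negative, put 0 on all children but one. The
  remaining child has the point \<open>(x1 / \<alpha>, x2 / \<alpha>)\<close>, where a nonnegative
  two-valued function does exist; \<open>s \<le> x1\<close> keeps its variance within
  \<open>\<epsilon>\<^sup>2\<close>.\<close>

lemma bellman_le_far:
  assumes "s \<le> x1" "x1\<^sup>2 \<le> x2" "x2 - x1\<^sup>2 \<le> \<epsilon>\<^sup>2"
  shows "bellman_le T \<epsilon> (x1, x2) x1"
proof (cases "\<alpha> * (x2 - x1\<^sup>2) \<le> x1\<^sup>2 * (1 - \<alpha>)")
  case True
  then show ?thesis using assms s_pos by (intro bellman_le_two_values_nonneg) auto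
next
  case False
  have x1: "0 < x1" using assms(1) s_pos by simp
  have sx: "\<alpha> * \<epsilon>\<^sup>2 \<le> x1\<^sup>2"
    unfolding s_square[symmetric] using assms(1) s_pos by (intro power_mono) auto
  have \<alpha>0: "\<alpha> \<noteq> 0" using \<alpha> by simp
  have child: "bellman_le T \<epsilon> (x1 / \<alpha>, x2 / \<alpha>) (x1 / \<alpha>)"
  proof (rule bellman_le_two_values_nonneg)
    show "0 \<le> x1 / \<alpha>" using x1 \<alpha> by simp
    have "x1\<^sup>2 \<le> \<alpha> * x2" using False by (simp add: algebra_simps)
    then show "(x1 / \<alpha>)\<^sup>2 \<le> x2 / \<alpha>"
      using \<alpha> by (simp add: power_divide divide_simps power2_eq_square) (simp add: algebra_simps)
    have "\<alpha> * x2 \<le> \<alpha> * (x1\<^sup>2 + \<epsilon>\<^sup>2)"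
      using assms(3) \<alpha> by (intro mult_left_mono) auto
    moreover have "\<alpha> * \<epsilon>\<^sup>2 * (1 - \<alpha>) \<le> x1\<^sup>2 * (1 - \<alpha>)"
      using sx \<alpha> by (intro mult_right_mono) auto
    ultimately have "\<alpha> * x2 - x1\<^sup>2 \<le> \<epsilon>\<^sup>2 * \<alpha>\<^sup>2"
      by (simp add: algebra_simps power2_eq_square)
    moreover have "x2 / \<alpha> - (x1 / \<alpha>)\<^sup>2 = (\<alpha> * x2 - x1\<^sup>2) / \<alpha>\<^sup>2"
      using \<alpha>0 by (simp add: power_divide diff_divide_distrib power2_eq_square)
    ultimately show "x2 / \<alpha> - (x1 / \<alpha>)\<^sup>2 \<le> \<epsilon>\<^sup>2"
      using \<alpha> by (simp add: pos_divide_le_eq)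
    \<comment> \<open>The nonnegativity condition on the child amounts to
      \<open>\<alpha>\<^sup>2 * x2 \<le> x1\<^sup>2\<close>, which follows from this inequality and
      \<open>sx\<close>.\<close>
    have "\<alpha>\<^sup>2 \<le> 1 - \<alpha>"
      using \<alpha> mult_mono[of \<alpha> "1/2" \<alpha> 1] by (simp add: power2_eq_square)
    then have "\<alpha>\<^sup>2 * x1\<^sup>2 \<le> (1 - \<alpha>) * x1\<^sup>2" by (intro mult_right_mono) auto
    moreover have "\<alpha>\<^sup>2 * x2 \<le> \<alpha>\<^sup>2 * (x1\<^sup>2 + \<epsilon>\<^sup>2)"
      using assms(3) by (intro mult_left_mono) auto
    moreover have "\<alpha> * (\<alpha> * \<epsilon>\<^sup>2) \<le> \<alpha> * x1\<^sup>2" using sx \<alpha> by (intro mult_left_mono) auto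
    ultimately have "\<alpha>\<^sup>2 * x2 \<le> x1\<^sup>2" by (simp add: algebra_simps power2_eq_square)
    then have "x2 \<le> (x1 / \<alpha>)\<^sup>2" using \<alpha> by (simp add: power_divide pos_le_divide_eq mult.commute)
    moreover have "\<alpha> * (x2 / \<alpha>) = x2" using \<alpha>0 by simp
    ultimately show "\<alpha> * (x2 / \<alpha> - (x1 / \<alpha>)\<^sup>2) \<le> (x1 / \<alpha>)\<^sup>2 * (1 - \<alpha>)"
      unfolding right_diff_distrib by (simp only: mult.commute[of \<alpha> "(x1 / \<alpha>)\<^sup>2"] mult_1_right)
  qed
  have "bellman_le T \<epsilon> (x1, x2) (\<alpha> * (x1 / \<alpha>) + (1 - \<alpha>) * \<bar>0\<bar>)"
    using \<alpha>0 \<epsilon> assms(3)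
    by (intro bellman_le_combine2[OF _ bellman_le_const child \<alpha>_def]) auto
  then show ?thesis using \<alpha>0 by simp
qed

text \<open>The bound \<open>x1\<close> is linear along rays from the origin, so it is interpolated
  between the origin and a point already treated. The slope limit \<open>s + q\<close> makes the ray
  reach abscissa \<open>s\<close> no higher than the upper parabola, as
  \<open>(s + q) * s = s\<^sup>2 + \<epsilon>\<^sup>2\<close>.\<close>

lemma bellman_le_near:
  assumes "0 \<le> x1" "x1 \<le> s" "x1\<^sup>2 \<le> x2" "x2 \<le> (s + q) * x1"
  shows "bellman_le T \<epsilon> (x1, x2) x1"
proof (cases "x1 = 0")
  case True
  then show ?thesis using assms bellman_le_const[of \<epsilon> T 0] \<epsilon> by simp
next
  case False
  then have x1: "0 < x1" using assms by simp
  define r where "r = x2 / x1"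
  have x2: "x2 = r * x1" using x1 by (simp add: r_def)
  have r: "x1 \<le> r" "r \<le> s + q"
    using assms x1 by (simp_all add: r_def pos_le_divide_eq pos_divide_le_eq power2_eq_square)
  txt \<open>The ray from the origin through the point meets the line \<open>x\<^sub>1 = s\<close> or the lower parabola,
    whichever comes first, at abscissa \<open>b\<close>.\<close>
  define b where "b = min s r"
  have b: "x1 \<le> b" "0 < b" "b \<le> s" "b \<le> r" using assms(2) r(1) x1 by (auto simp: b_def)
  have var: "r * b - b\<^sup>2 \<le> \<epsilon>\<^sup>2"
  proof (cases "r \<le> s")
    case True
    then show ?thesis by (simp add: b_def power2_eq_square)
  next
    case False
    have "r * s \<le> (s + q) * s" using r(2) s_pos by (intro mult_right_mono) auto
    then show ?thesis
      using False s_mult_q by (simp add: b_def power2_eq_square algebra_simps)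
  qed
  have B: "bellman_le T \<epsilon> (b, r * b) b"
  proof (cases "r \<le> s")
    case True
    then show ?thesis
      using bellman_le_const[of \<epsilon> T b] \<epsilon> b by (simp add: b_def power2_eq_square)
  next
    case False
    then show ?thesis
      using var b by (intro bellman_le_far) (auto simp: b_def power2_eq_square)
  qed
  define \<theta> where "\<theta> = x1 / b"
  have \<theta>: "0 \<le> \<theta>" "\<theta> \<le> 1" "\<theta> * b = x1" using b x1 by (auto simp: \<theta>_def)
  have bE: "b\<^sup>2 \<le> \<epsilon>\<^sup>2"
    using power_mono[OF b(3), of 2] b(2) s_square_le by simp
  have "bellman_le T \<epsilon> ((1 - \<theta>) * 0 + \<theta> * b, (1 - \<theta>) * 0\<^sup>2 + \<theta> * (r * b)) ((1 - \<theta>) * \<bar>0\<bar> + \<theta> * b)"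
  proof (rule bellman_le_segment[OF _ bellman_le_const B])
    fix t :: real assume t: "0 \<le> t" "t \<le> 1"
    have "t * b * (t * b) \<le> t * b * (1 * r)"
      using t b by (intro mult_left_mono mult_mono) auto
    then show "((1 - t) * 0 + t * b)\<^sup>2 \<le> (1 - t) * 0\<^sup>2 + t * (r * b)"
      by (simp add: power2_eq_square mult_ac)
    have "t * (r * b - b\<^sup>2) \<le> t * \<epsilon>\<^sup>2" using t var by (intro mult_left_mono) auto
    \<comment> \<open>Split \<open>t * r * b - (t * b)\<^sup>2\<close> into
      \<open>t * (r * b - b\<^sup>2)\<close> and \<open>t * (1 - t) * b\<^sup>2\<close>; they are at
      most \<open>t * \<epsilon>\<^sup>2\<close> and
      \<open>(1 - t) * \<epsilon>\<^sup>2\<close>.\<close>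
    moreover have "0 \<le> (1 - t) * (\<epsilon>\<^sup>2 - t * b\<^sup>2)"
      using t bE mult_left_le_one_le[of "b\<^sup>2" t] by (intro mult_nonneg_nonneg) auto
    ultimately show "(1 - t) * 0\<^sup>2 + t * (r * b) - ((1 - t) * 0 + t * b)\<^sup>2 \<le> \<epsilon>\<^sup>2"
      by (simp add: power2_eq_square algebra_simps)
  qed (use \<epsilon> b \<theta> in auto)
  moreover have "\<theta> * (r * b) = x2" using \<theta>(3) x2 by (metis mult.left_commute)
  ultimately show ?thesis by (simp add: \<theta>(3))
qed

text \<open>On both edges \<open>x2 = (s + q) * \<bar>x1\<bar>\<close> the bound from
  \<open>bellman_le_near\<close> equals \<open>x2 / (s + q)\<close>, so a segment joining the edges
  carries this linear formula inside.\<close>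

lemma bellman_le_centre:
  assumes "\<bar>x1\<bar> \<le> s" "(s + q) * \<bar>x1\<bar> \<le> x2" "x2 \<le> x1\<^sup>2 + \<epsilon>\<^sup>2"
  shows "bellman_le T \<epsilon> (x1, x2) (x2 / (s + q))"
proof -
  define c where "c = s + q"
  have c: "3 * s \<le> c" "0 < c" "c * s = s\<^sup>2 + \<epsilon>\<^sup>2"
    using q_ge s_pos s_mult_q by (auto simp: c_def algebra_simps power2_eq_square)
  have pos: "0 < c - 2 * x1" "0 < c + 2 * x1" using assms(1) c s_pos by auto
  txt \<open>The line of slope \<open>2 x\<^sub>1\<close> through the point stays below the upper parabola. It meets the two
    edges \<open>x\<^sub>2 = c |x\<^sub>1|\<close> at the abscissae \<open>u\<close> and \<open>- w\<close>.\<close>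
  define u w where "u = (x2 - 2 * x1\<^sup>2) / (c - 2 * x1)" and "w = (x2 - 2 * x1\<^sup>2) / (c + 2 * x1)"
  have u: "c * u = x2 + 2 * x1 * (u - x1)"
    using pos(1) by (simp add: u_def field_simps power2_eq_square)
  have w: "c * w = x2 + 2 * x1 * (- w - x1)"
    using pos(2) by (simp add: w_def field_simps power2_eq_square)
  have cx: "c * x1 \<le> x2" "c * (- x1) \<le> x2"
    using assms(2) c(2) abs_ge_self[of x1] abs_ge_minus_self[of x1]
    by (smt (verit, best) c_def mult_left_mono)+
  have num: "0 \<le> x2 - 2 * x1\<^sup>2"
  proof -
    have "2 * \<bar>x1\<bar> * \<bar>x1\<bar> \<le> c * \<bar>x1\<bar>" using assms(1) c s_pos by (intro mult_right_mono) auto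
    then show ?thesis using assms(2) by (simp add: c_def power2_eq_square)
  qed
  have u0: "0 \<le> u" "0 \<le> w" using num pos by (auto simp: u_def w_def)
  \<comment> \<open>The line must meet the edges at abscissae of modulus at most \<open>s\<close>,
    where \<open>edge\<close> is available.\<close>
  have "x2 - 2 * x1\<^sup>2 \<le> s * (c - 2 * x1)"
    using assms(3) c(3) zero_le_power2[of "s - x1"] by (simp add: power2_eq_square algebra_simps)
  then have us: "u \<le> s" using pos(1) by (simp add: u_def pos_divide_le_eq)
  have "x2 - 2 * x1\<^sup>2 \<le> s * (c + 2 * x1)"
    using assms(3) c(3) zero_le_power2[of "s + x1"] by (simp add: power2_eq_square algebra_simps)
  then have ws: "w \<le> s" using pos(2) by (simp add: w_def pos_divide_le_eq)
  have ux: "x1 \<le> u" using cx(1) pos(1) by (simp add: u_def pos_le_divide_eq power2_eq_square algebra_simps)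
  have wx: "- x1 \<le> w" using cx(2) pos(2) by (simp add: w_def pos_le_divide_eq power2_eq_square algebra_simps)
  have edge: "bellman_le T \<epsilon> (z, c * z) z" if "0 \<le> z" "z \<le> s" for z
    using that c s_pos unfolding c_def
    by (intro bellman_le_near) (auto simp: power2_eq_square intro: mult_right_mono)
  have P: "bellman_le T \<epsilon> (u, c * u) u" using edge u0 us by blast
  have N: "bellman_le T \<epsilon> (- w, c * w) w" using bellman_le_uminus[OF _ edge] \<epsilon> u0 ws by simp
  obtain \<theta> where \<theta>: "0 \<le> \<theta>" "\<theta> \<le> 1" "(1 - \<theta>) * (- w) + \<theta> * u = x1"
  proof (cases "u + w = 0")
    \<comment> \<open>The segment degenerates to the origin, and any parameter works.\<close>
    case True
    then show thesis using that[of 0] u0 ux wx by auto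
  next
    case False
    then have "0 < u + w" using u0 by simp
    define t where "t = (x1 + w) / (u + w)"
    have "t * (u + w) = x1 + w" using False by (simp add: t_def)
    then have "(1 - t) * (- w) + t * u = x1" by (simp add: algebra_simps)
    moreover have "0 \<le> t" "t \<le> 1" using ux wx \<open>0 < u + w\<close> by (auto simp: t_def)
    ultimately show thesis using that by blast
  qed
  have line: "(1 - t) * (c * w) + t * (c * u) = x2 + 2 * x1 * ((1 - t) * (- w) + t * u - x1)" for t
    unfolding u w by (simp add: algebra_simps)
  have "bellman_le T \<epsilon> ((1 - \<theta>) * (- w) + \<theta> * u, (1 - \<theta>) * (c * w) + \<theta> * (c * u)) ((1 - \<theta>) * w + \<theta> * u)"
  proof (rule bellman_le_segment[OF _ N P u0(2) u0(1)])
    fix t :: real assume t: "0 \<le> t" "t \<le> 1"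
    define z y where "z = (1 - t) * (- w) + t * u" and "y = (1 - t) * w + t * u"
    have zy: "\<bar>z\<bar> \<le> y" using t u0 by (auto simp: z_def y_def abs_le_iff)
    have "y \<le> (1 - t) * s + t * s"
      unfolding y_def using t us ws by (intro add_mono mult_left_mono) auto
    then have "y \<le> c" using c s_pos by (simp add: algebra_simps)
    then have "\<bar>z\<bar> * \<bar>z\<bar> \<le> c * y" using zy by (intro mult_mono) auto
    then show "((1 - t) * (- w) + t * u)\<^sup>2 \<le> (1 - t) * (c * w) + t * (c * u)"
      unfolding z_def[symmetric] by (simp add: y_def power2_eq_square algebra_simps)
    \<comment> \<open>At abscissa \<open>z\<close> the height above the lower parabola is
      \<open>x2 - x1\<^sup>2 - (z - x1)\<^sup>2\<close>, so it is largest at the given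
      point.\<close>
    show "(1 - t) * (c * w) + t * (c * u) - ((1 - t) * (- w) + t * u)\<^sup>2 \<le> \<epsilon>\<^sup>2"
      unfolding line z_def[symmetric]
      using assms(3) zero_le_power2[of "z - x1"] by (simp add: power2_eq_square algebra_simps)
  qed (use \<epsilon> \<theta> in auto)
  moreover have "(1 - \<theta>) * w + \<theta> * u = x2 / c"
    using line[of \<theta>] c(2) unfolding \<theta>(3) by (simp add: field_simps)
  ultimately show ?thesis unfolding \<theta>(3) line by (simp add: c_def)
qed

end

theorem theorem4p2:
  fixes Q :: "(real ^ 'n) set" and \<epsilon> :: real and x :: "real \<times> real"
  assumes "Q \<in> dyadic_cubes" and "\<epsilon> > 0" and "x \<in> Omega \<epsilon>"
  shows "bellman Q \<epsilon> x = ereal (b_alpha (2 powi (- int CARD('n))) \<epsilon> x)"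
proof -
  define \<alpha> :: real where "\<alpha> = (1/2) ^ CARD('n)"
  have powi: "2 powi (- int CARD('n)) = \<alpha>"
    by (simp add: \<alpha>_def power_int_minus power_one_over inverse_eq_divide)
  have \<alpha>: "0 < \<alpha>" "\<alpha> \<le> 1/2" using half_power_card[where 'n = 'n] by (auto simp: \<alpha>_def)
  define s q where "s = sqrt \<alpha> * \<epsilon>" and "q = \<epsilon> / sqrt \<alpha>"
  have sqrt: "sqrt \<alpha> * sqrt \<alpha> = \<alpha>" "0 < sqrt \<alpha>" using \<alpha> by auto
  interpret bellman_parameters "TYPE('n)" \<epsilon> \<alpha> s q
  proof
    show "\<alpha> = (1/2) ^ CARD('n)" by (rule \<alpha>_def)
    show "0 < s" using sqrt assms(2) by (simp add: s_def)
    show "s * q = \<epsilon>\<^sup>2" using sqrt(2) by (simp add: s_def q_def power2_eq_square)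
    have "\<alpha> * q = sqrt \<alpha> * (sqrt \<alpha> * q)" using sqrt(1) by (metis mult.assoc)
    then show "s = \<alpha> * q" using sqrt(2) by (simp add: s_def q_def)
  qed (rule assms(2))
  have c: "(1 + \<alpha>) * \<epsilon> / sqrt \<alpha> = s + q"
  proof -
    have "\<alpha> * \<epsilon> / sqrt \<alpha> = (\<alpha> / sqrt \<alpha>) * \<epsilon>" by simp
    also have "\<dots> = s" using \<alpha>(1) unfolding s_def by (subst real_div_sqrt) auto
    finally have "\<alpha> * \<epsilon> / sqrt \<alpha> = s" .
    then show ?thesis by (simp add: q_def distrib_right add_divide_distrib)
  qed
  obtain x1 x2 where x: "x = (x1, x2)" by (cases x)
  have \<Omega>: "x1\<^sup>2 \<le> x2" "x2 \<le> x1\<^sup>2 + \<epsilon>\<^sup>2" using assms(3) by (auto simp: x Omega_def)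
  have "bellman_le TYPE('n) \<epsilon> x (b_alpha \<alpha> \<epsilon> x)"
  proof (cases "x \<in> Omega0 \<alpha> \<epsilon>")
    case True
    then have "bellman_le TYPE('n) \<epsilon> x (x2 / (s + q))"
      unfolding x by (intro bellman_le_centre) (auto simp: Omega0_def c s_def[symmetric])
    then show ?thesis using True by (simp add: b_alpha_on_Omega0 x c[symmetric] mult.commute)
  next
    case False
    then have x': "s < \<bar>x1\<bar> \<or> x2 \<le> (s + q) * \<bar>x1\<bar>"
      using \<Omega> by (auto simp: Omega0_def x c s_def[symmetric])
    \<comment> \<open>By the reflection \<open>bellman_le_uminus\<close> only the abscissa
      \<open>\<bar>x1\<bar>\<close> needs to be treated.\<close>
    have "bellman_le TYPE('n) \<epsilon> (\<bar>x1\<bar>, x2) \<bar>x1\<bar>"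
    proof (cases "s \<le> \<bar>x1\<bar>")
      case True
      then show ?thesis using \<Omega> by (intro bellman_le_far) auto
    next
      case False
      then show ?thesis using \<Omega> x' by (intro bellman_le_near) auto
    qed
    then have "bellman_le TYPE('n) \<epsilon> x \<bar>x1\<bar>"
      using bellman_le_uminus[of \<epsilon> "TYPE('n)" "\<bar>x1\<bar>"] assms(2) by (cases "0 \<le> x1") (auto simp: x)
    then show ?thesis using False by (simp add: b_alpha_def x)
  qed
  then have "bellman Q \<epsilon> x \<le> ereal (b_alpha \<alpha> \<epsilon> x)"
    using assms(1) by (simp add: bellman_le_def)
  then show ?thesis
    using bellman_ge_b_alpha[OF assms(1,2), of x] unfolding powi \<alpha>_def by (intro antisym)
qed

end
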